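(* Let $0<q\le p$ satisfy $p^2+q^2<1$, and suppose there is $\tilde\delta\in(0,1)$ such that $\mathcal S_{p,q}(\delta)<0$ for all $0<\delta<\tilde\delta$. Let $g_0$ be a function on $\mathbb R$ with $g_0\ge 0$, $\int_{\mathbb R} g_0(v)\,dv=1$, $\int_{\mathbb R} v\,g_0(v)\,dv=0$, $\int_{\mathbb R} v^2 g_0(v)\,dv=1$, and $$\int_{\mathbb R}|v|^{2+\tilde\delta}g_0(v)\,dv<+\infty .$$ Let $g(t)=g(\cdot,t)$ be the weak solution of the scaled equation $$\partial_t\hat g(\xi,t)+\tfrac12(p^2+q^2-1)\,\xi\,\partial_\xi\hat g(\xi,t)=\hat g(p\xi,t)\,\hat g(q\xi,t)-\hat g(\xi,t)$$ corresponding to the initial density $g_0$. If in addition $$|\hat g_0(\xi)|\le\frac1{(1+\beta|\xi|)^{\nu}},\qquad |\xi|>R,$$ for some $R>0$, $\nu>0$ and $\beta>0$, then there exist $\rho>0$, $k>0$, $\beta'>0$, $\nu'>0$ such that for all $t\ge0$ $$|\hat g(\xi,t)|\le\frac1{1+k\xi^2}\quad\text{for }|\xi|\le\rho,\qquad |\hat g(\xi,t)|\le\frac1{(1+\beta'|\xi|)^{\nu'}}\quad\text{for }|\xi|>\rho .$$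
   Context: For $p,q>0$ and $\delta\ge0$, $\mathcal S_{p,q}(\delta)=p^{2+\delta}+q^{2+\delta}-1-\frac{2+\delta}{2}\,(p^2+q^2-1)$. The Fourier transform is $\hat h(\xi)=\int_{\mathbb R}h(v)e^{-i\xi v}\,dv$ (in the variable $v$ only). Weak solution of the scaled equation with initial density $g_0$: let $f\in C^1([0,+\infty),L^1(\mathbb R))$ be the unique nonnegative solution (known to exist, with unit mass and zero mean for all times) of $\partial_t\hat f(\xi,t)=\hat f(p\xi,t)\hat f(q\xi,t)-\hat f(\xi,t)$, $\hat f(\xi,0)=\hat g_0(\xi)$. Its second moment is $E(t)=\int_{\mathbb R} v^2f(v,t)\,dv=e^{(p^2+q^2-1)t}$. Then $g(v,t)=\sqrt{E(t)}\,f(v\sqrt{E(t)},t)$, equivalently $\hat g(\xi,t)=\hat f(\xi/\sqrt{E(t)},t)$; $g$ solves the scaled equation with $g(\cdot,0)=g_0$ and $\int_{\mathbb R} v^2g(v,t)\,dv=1$ for all $t\ge0$. *)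

theory Defs
  imports "HOL-Analysis.Analysis"
begin

definition S_fun :: "real \<Rightarrow> real \<Rightarrow> real \<Rightarrow> real" where
  "S_fun p q \<delta> =
     p powr (2 + \<delta>) + q powr (2 + \<delta>) - 1 - (2 + \<delta>) / 2 * (p\<^sup>2 + q\<^sup>2 - 1)"

definition fourier :: "(real \<Rightarrow> real) \<Rightarrow> real \<Rightarrow> complex" where
  "fourier h \<xi> = (LINT v|lebesgue. complex_of_real (h v) * exp (- (\<i> * complex_of_real (\<xi> * v))))"

(* C^1([0,oo), L^1(R)): a curve f, with f t a representative of an element of L^1(R) for t >= 0,
   has an L^1-norm derivative f' (one-sided at t = 0) that is itself continuous in L^1. *)
definition C1_L1 :: "(real \<Rightarrow> real \<Rightarrow> real) \<Rightarrow> bool" where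
  "C1_L1 f \<longleftrightarrow>
     (\<exists>f'. (\<forall>t\<ge>0. integrable lebesgue (f t) \<and> integrable lebesgue (f' t)) \<and>
        (\<forall>t\<ge>0. ((\<lambda>s. LINT v|lebesgue. \<bar>(f s v - f t v) / (s - t) - f' t v\<bar>) \<longlongrightarrow> 0)
                  (at t within {0..})) \<and>
        (\<forall>t\<ge>0. ((\<lambda>s. LINT v|lebesgue. \<bar>f' s v - f' t v\<bar>) \<longlongrightarrow> 0) (at t within {0..})))"

(* Throughout, f t v stands for f(v,t); only times t >= 0 matter.  Unit mass, zero mean and the
   value exp ((p^2 + q^2 - 1) t) of the second moment are consequences and are not assumed. *)
definition weak_solution ::
  "real \<Rightarrow> real \<Rightarrow> (real \<Rightarrow> real) \<Rightarrow> (real \<Rightarrow> real \<Rightarrow> real) \<Rightarrow> bool" where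
  "weak_solution p q g0 f \<longleftrightarrow>
     C1_L1 f \<and>
     (\<forall>t\<ge>0. AE v in lebesgue. 0 \<le> f t v) \<and>
     (\<forall>\<xi>. fourier (f 0) \<xi> = fourier g0 \<xi>) \<and>
     (\<forall>\<xi>. \<forall>t\<ge>0. ((\<lambda>s. fourier (f s) \<xi>) has_vector_derivative
        (fourier (f t) (p * \<xi>) * fourier (f t) (q * \<xi>) - fourier (f t) \<xi>)) (at t within {0..}))"

definition second_moment :: "(real \<Rightarrow> real) \<Rightarrow> real" where
  "second_moment h = (LINT v|lebesgue. v\<^sup>2 * h v)"

(* The weak solution of the scaled equation
     d_t g^ + (p^2 + q^2 - 1)/2 * xi * d_xi g^ = g^(p xi) g^(q xi) - g^(xi)
   is by definition the unit-energy rescaling of the weak solution f of the unscaled one. *)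
definition scaled_weak_solution ::
  "real \<Rightarrow> real \<Rightarrow> (real \<Rightarrow> real) \<Rightarrow> (real \<Rightarrow> real \<Rightarrow> real) \<Rightarrow> bool" where
  "scaled_weak_solution p q g0 g \<longleftrightarrow>
     (\<exists>f. weak_solution p q g0 f \<and>
        (\<forall>t\<ge>0. \<forall>v. g t v =
           sqrt (second_moment (f t)) * f t (v * sqrt (second_moment (f t)))))"

end

theory Submission
  imports Defs "HOL-Probability.Characteristic_Functions" "HOL-Real_Asymp.Real_Asymp"
begin

text \<open>
  Write \<open>b = (1 - p\<^sup>2 - q\<^sup>2) / 2\<close> and let \<open>\<phi>(\<xi>, t)\<close> be the Fourier transform of the unscaled solution, so
  that \<open>\<phi>' = \<phi>(p \<xi>, t) \<phi>(q \<xi>, t) - \<phi>\<close>, the energy is \<open>exp (- 2 b t)\<close>, and the scaled solution has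
  transform \<open>\<phi>(\<xi> exp (b t), t)\<close>.  The proof works with \<open>\<phi>\<close> at a fixed frequency \<open>\<xi>\<close>, viewed through the
  scaled frequency \<open>\<eta> = \<bar>\<xi>\<bar> exp (- b t)\<close>, which decreases in time.  The main estimates compare
  this scalar differential equation with a real supersolution (\<open>norm_le_supersolution\<close>).

  Low frequencies.  With \<open>s = 2 + \<delta>\<close>, the error of the Gaussian \<open>exp (- \<eta>\<^sup>2 / 2)\<close> as an
  approximate solution is at most \<open>\<eta> powr s\<close>, and the equation for the difference \<open>w\<close> to it contracts
  \<open>sup \<bar>w(\<xi>)\<bar> / \<bar>\<xi>\<bar> powr s\<close> at rate \<open>1 - p powr s - q powr s\<close>.  The condition \<open>S(\<delta>) < 0\<close> says exactly
  that this rate exceeds \<open>b s\<close>, the decay rate of \<open>\<eta> powr s\<close>.  Hence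
  \<open>\<bar>\<phi> - exp (- \<eta>\<^sup>2 / 2)\<bar> \<le> K \<eta> powr s\<close> uniformly in time (\<open>weak_solution_near_gaussian\<close>).  This
  expansion determines the second moment at positive times, which is not known to be finite beforehand
  (\<open>second_moment_of_near_gaussian\<close>), and, as \<open>s > 2\<close>, the bound \<open>1 / (1 + \<eta>\<^sup>2 / 4)\<close> on an interval
  \<open>\<eta> \<le> \<rho>\<close>.

  High frequencies.  Extend this bound beyond \<open>\<rho>\<close> by \<open>c (\<eta> / \<rho>) powr (- \<nu>)\<close> to an envelope \<open>U\<close>.  If \<open>c < 1\<close> is
  close to 1 and \<open>\<nu>\<close> is small enough, then \<open>U(p \<eta>) U(q \<eta>) \<le> U(\<eta>)\<close> for \<open>\<eta> > \<rho>\<close>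
  (\<open>envelope_product_le\<close>): two factors that are both bounded away from 1 gain more than the slow power loses.
  Since \<open>U(\<eta>)\<close> increases in time along a fixed \<open>\<xi>\<close>, it is a supersolution for as long as \<open>\<eta> > \<rho>\<close>, after
  which the low-frequency bound takes over.  The factors \<open>\<phi>(p \<xi>)\<close> and \<open>\<phi>(q \<xi>)\<close> live at smaller
  frequencies, so the bound spreads from \<open>\<bar>\<xi>\<bar> \<le> \<rho> / p ^ n\<close> to \<open>\<bar>\<xi>\<bar> \<le> \<rho> / p ^ Suc n\<close>
  (\<open>weak_solution_below_envelope\<close>).  At time 0 the envelope dominates because the transform of a density is
  continuous and has modulus less than 1 off the origin, which covers the compact part, while the assumed
  decay covers the rest (\<open>envelope_parameters\<close>).
\<close>

section \<open>Comparison with supersolutions\<close>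

text \<open>
  The factor \<open>exp t\<close> absorbs the damping term: the derivative of \<open>exp t *\<^sub>R y t\<close> has norm at most that
  of \<open>exp t * H t\<close>.
\<close>

lemma norm_le_supersolution:
  fixes y N :: "real \<Rightarrow> complex" and H H' :: "real \<Rightarrow> real"
  assumes "0 \<le> T"
    and y: "\<And>t. 0 \<le> t \<Longrightarrow> t \<le> T \<Longrightarrow> (y has_vector_derivative (N t - y t)) (at t within {0..})"
    and H: "\<And>t. 0 \<le> t \<Longrightarrow> t \<le> T \<Longrightarrow> (H has_real_derivative H' t) (at t)"
    and N: "\<And>t. 0 \<le> t \<Longrightarrow> t \<le> T \<Longrightarrow> norm (N t) \<le> H' t + H t"
    and init: "norm (y 0) \<le> H 0"
  shows "norm (y T) \<le> H T"
proof (cases "T = 0")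
  case True
  then show ?thesis using init by simp
next
  case False
  with \<open>0 \<le> T\<close> have "0 < T" by simp
  have cont_y: "continuous_on {0..T} y"
    unfolding continuous_on_eq_continuous_within
  proof
    fix t assume "t \<in> {0..T}"
    then have "continuous (at t within {0..}) y"
      using y[of t] has_vector_derivative_continuous by auto
    then show "continuous (at t within {0..T}) y"
      by (rule continuous_within_subset) auto
  qed
  have cont_H: "continuous_on {0..T} H"
    unfolding continuous_on_eq_continuous_within
  proof
    fix t assume "t \<in> {0..T}"
    then have "isCont H t" using H[of t] DERIV_isCont by auto
    then show "continuous (at t within {0..T}) H"
      by (rule continuous_at_imp_continuous_at_within)
  qed
  have "norm (exp T *\<^sub>R y T - exp 0 *\<^sub>R y 0) \<le> exp T * H T - exp 0 * H 0"
  proof (rule differentiable_bound_general[OF \<open>0 < T\<close>,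
        where f' = "\<lambda>t. exp t *\<^sub>R N t" and \<phi>' = "\<lambda>t. exp t * (H' t + H t)"])
    show "continuous_on {0..T} (\<lambda>t. exp t *\<^sub>R y t)"
      by (intro continuous_intros cont_y)
    show "continuous_on {0..T} (\<lambda>t. exp t * H t)"
      by (intro continuous_intros cont_H)
  next
    fix t assume t: "0 < t" "t < T"
    have "at t within {0..} = at t"
      using t by (intro at_within_interior) auto
    then have y': "(y has_vector_derivative (N t - y t)) (at t)"
      using y[of t] t by simp
    have e: "(exp has_real_derivative exp t) (at t)" by simp
    show "((\<lambda>t. exp t *\<^sub>R y t) has_vector_derivative exp t *\<^sub>R N t) (at t)"
      using has_vector_derivative_scaleR[OF e y'] by (simp add: algebra_simps)
    have "((\<lambda>t. exp t * H t) has_real_derivative exp t * (H' t + H t)) (at t)"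
      using DERIV_mult[OF e H[of t]] t by (simp add: algebra_simps)
    then show "((\<lambda>t. exp t * H t) has_vector_derivative exp t * (H' t + H t)) (at t)"
      by (simp add: has_real_derivative_iff_has_vector_derivative)
    show "norm (exp t *\<^sub>R N t) \<le> exp t * (H' t + H t)"
      using N[of t] t by simp
  qed
  moreover have "exp T * norm (y T) - norm (y 0) \<le> norm (exp T *\<^sub>R y T - exp 0 *\<^sub>R y 0)"
    using norm_triangle_ineq2[of "exp T *\<^sub>R y T" "y 0"] by simp
  ultimately have "exp T * norm (y T) \<le> exp T * H T"
    using init unfolding exp_zero scaleR_one mult_1_left by linarith
  then show ?thesis by simp
qed

section \<open>Fourier transforms of densities\<close>

lemma fourier_integrand_integrable:
  assumes "integrable lebesgue h"
  shows "integrable lebesgue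
    (\<lambda>v. complex_of_real (h v) * exp (- (\<i> * complex_of_real (\<xi> * v))))"
proof (rule Bochner_Integration.integrable_bound[OF assms])
  have [measurable]: "h \<in> borel_measurable lebesgue" using assms by auto
  have "(\<lambda>v. exp (- (\<i> * complex_of_real (\<xi> * v)))) \<in> borel_measurable borel"
    by (intro borel_measurable_continuous_onI continuous_intros)
  then have [measurable]: "(\<lambda>v. exp (- (\<i> * complex_of_real (\<xi> * v)))) \<in> borel_measurable lebesgue"
    by (simp add: measurable_completion)
  show "(\<lambda>v. complex_of_real (h v) * exp (- (\<i> * complex_of_real (\<xi> * v))))
      \<in> borel_measurable lebesgue"
    by measurable
qed (auto simp: norm_mult)

lemma norm_fourier_le_integral:
  assumes "integrable lebesgue h" and "AE v in lebesgue. 0 \<le> h v"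
  shows "norm (fourier h \<xi>) \<le> (LINT v|lebesgue. h v)"
  unfolding fourier_def
proof -
  let ?F = "\<lambda>v. complex_of_real (h v) * exp (- (\<i> * complex_of_real (\<xi> * v)))"
  have "norm (integral\<^sup>L lebesgue ?F) \<le> (LINT v|lebesgue. norm (?F v))"
    by (rule integral_norm_bound)
  also have "\<dots> = (LINT v|lebesgue. h v)"
  proof (rule integral_cong_AE)
    show "(\<lambda>v. norm (?F v)) \<in> borel_measurable lebesgue"
      using fourier_integrand_integrable[OF assms(1)] by auto
  qed (use assms in \<open>auto simp: norm_mult\<close>)
  finally show "norm (integral\<^sup>L lebesgue ?F) \<le> (LINT v|lebesgue. h v)" .
qed

lemma Re_fourier:
  assumes "integrable lebesgue h"
  shows "integrable lebesgue (\<lambda>v. h v * cos (\<xi> * v + \<theta>))"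
    and "Re (fourier h \<xi> * cis (- \<theta>)) = (LINT v|lebesgue. h v * cos (\<xi> * v + \<theta>))"
proof -
  let ?F = "\<lambda>v. complex_of_real (h v) * exp (- (\<i> * complex_of_real (\<xi> * v)))"
  have F: "integrable lebesgue ?F"
    using assms by (rule fourier_integrand_integrable)
  have eq: "Re (?F v * cis (- \<theta>)) = h v * cos (\<xi> * v + \<theta>)" for v
  proof -
    have "exp (- (\<i> * complex_of_real (\<xi> * v))) = cis (- (\<xi> * v))"
      by (simp add: cis_conv_exp)
    then have "?F v * cis (- \<theta>) = complex_of_real (h v) * cis (- (\<xi> * v + \<theta>))"
      by (simp add: cis_mult)
    then have "Re (?F v * cis (- \<theta>)) = Re (complex_of_real (h v) * cis (- (\<xi> * v + \<theta>)))"
      by (rule arg_cong)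
    also have "\<dots> = h v * cos (\<xi> * v + \<theta>)"
      by (simp del: minus_add_distrib)
    finally show ?thesis .
  qed
  have F': "integrable lebesgue (\<lambda>v. ?F v * cis (- \<theta>))"
    using F by (rule Bochner_Integration.integrable_mult_left)
  show "integrable lebesgue (\<lambda>v. h v * cos (\<xi> * v + \<theta>))"
    using integrable_Re[OF F'] unfolding eq .
  have "fourier h \<xi> * cis (- \<theta>) = (LINT v|lebesgue. ?F v * cis (- \<theta>))"
    unfolding fourier_def by simp
  then have "Re (fourier h \<xi> * cis (- \<theta>)) = (LINT v|lebesgue. Re (?F v * cis (- \<theta>)))"
    using integral_Re[OF F'] by simp
  then show "Re (fourier h \<xi> * cis (- \<theta>)) = (LINT v|lebesgue. h v * cos (\<xi> * v + \<theta>))"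
    unfolding eq .
qed

text \<open>
  If the modulus were 1, the density would live where a single phase \<open>cos (\<xi> v + \<theta>)\<close> equals 1, which is a
  countable set of points.
\<close>

lemma norm_fourier_less_mass:
  assumes "integrable lebesgue h" and "AE v in lebesgue. 0 \<le> h v"
    and "(LINT v|lebesgue. h v) = 1" and "\<xi> \<noteq> 0"
  shows "norm (fourier h \<xi>) < 1"
proof (rule ccontr)
  assume "\<not> ?thesis"
  then have ge: "1 \<le> norm (fourier h \<xi>)" by simp
  define \<theta> where "\<theta> = Arg (fourier h \<xi>)"
  have "fourier h \<xi> = rcis (norm (fourier h \<xi>)) \<theta>"
    unfolding \<theta>_def by (simp add: rcis_cmod_Arg)
  then have "fourier h \<xi> * cis (- \<theta>) = complex_of_real (norm (fourier h \<xi>))"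
    by (metis (no_types) ab_group_add_class.ab_left_minus add.commute cis_mult cis_zero mult.assoc mult.right_neutral rcis_def)
  then have "norm (fourier h \<xi>) = (LINT v|lebesgue. h v * cos (\<xi> * v + \<theta>))"
    using Re_fourier(2)[OF assms(1), of \<xi> \<theta>] by simp
  note I = Re_fourier(1)[OF assms(1), of \<xi> \<theta>] this
  let ?D = "\<lambda>v. h v - h v * cos (\<xi> * v + \<theta>)"
  have D: "integrable lebesgue ?D" using assms(1) I(1) by simp
  have D0: "AE v in lebesgue. 0 \<le> ?D v"
    using assms(2)
  proof eventually_elim
    case (elim v)
    then show ?case using mult_left_mono[OF cos_le_one[of "\<xi> * v + \<theta>"] elim] by simp
  qed
  have "(LINT v|lebesgue. ?D v) = 1 - norm (fourier h \<xi>)"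
    using assms(1,3) I by simp
  moreover have "0 \<le> (LINT v|lebesgue. ?D v)"
    by (rule integral_nonneg_AE[OF D0])
  ultimately have "(LINT v|lebesgue. ?D v) = 0" using ge by simp
  then have AED: "AE v in lebesgue. ?D v = 0"
    using integral_nonneg_eq_0_iff_AE[OF D D0] by simp
  let ?Z = "range (\<lambda>n::int. (of_int n * 2 * pi - \<theta>) / \<xi>)"
  have "?Z \<in> null_sets lebesgue"
    using countable_imp_null_set_lborel[of ?Z] null_sets_completionI by auto
  then have "AE v in lebesgue. v \<notin> ?Z" by (rule AE_not_in)
  with AED have "AE v in lebesgue. h v = 0"
  proof eventually_elim
    case (elim v)
    show ?case
    proof (rule ccontr)
      assume "h v \<noteq> 0"
      with elim have "cos (\<xi> * v + \<theta>) = 1" by (simp add: field_simps)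
      then obtain n :: int where "\<xi> * v + \<theta> = of_int n * 2 * pi"
        using cos_one_2pi_int by auto
      then have "v = (of_int n * 2 * pi - \<theta>) / \<xi>" using assms(4) by (simp add: field_simps)
      with elim show False by blast
    qed
  qed
  then have "(LINT v|lebesgue. h v) = 0"
    by (rule integral_eq_zero_AE)
  with assms(3) show False by simp
qed

lemma continuous_on_fourier:
  assumes "integrable lebesgue h"
  shows "continuous_on S (fourier h)"
proof -
  have I: "integrable lebesgue (\<lambda>v. complex_of_real (h v) * exp (- (\<i> * complex_of_real (\<xi> * v))))" for \<xi>
    using assms by (rule fourier_integrand_integrable)
  have "isCont (fourier h) \<xi>" for \<xi>
    unfolding continuous_at_sequentially
  proof (intro allI impI)
    fix X :: "nat \<Rightarrow> real" assume X: "X \<longlonglongrightarrow> \<xi>"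
    show "(fourier h \<circ> X) \<longlonglongrightarrow> fourier h \<xi>"
      unfolding fourier_def comp_def
    proof (rule integral_dominated_convergence[where w = "\<lambda>v. \<bar>h v\<bar>"])
      show "integrable lebesgue (\<lambda>v. \<bar>h v\<bar>)" using assms by simp
      show "AE v in lebesgue. (\<lambda>n. complex_of_real (h v) * exp (- (\<i> * complex_of_real (X n * v))))
          \<longlonglongrightarrow> complex_of_real (h v) * exp (- (\<i> * complex_of_real (\<xi> * v)))"
        by (intro AE_I2 tendsto_intros X)
    qed (use I in \<open>auto simp: norm_mult\<close>)
  qed
  then show ?thesis
    by (simp add: continuous_at_imp_continuous_on)
qed

lemma fourier_rescale:
  assumes "0 < c"
  shows "fourier (\<lambda>v. c * h (v * c)) \<xi> = fourier h (\<xi> / c)"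
proof -
  have "fourier h (\<xi> / c) = \<bar>c\<bar> *\<^sub>R (LINT v|lebesgue. complex_of_real (h (0 + c * v))
      * exp (- (\<i> * complex_of_real (\<xi> / c * (0 + c * v)))))"
    unfolding fourier_def by (rule lebesgue_integral_real_affine) (use assms in simp)
  also have "\<dots> = (LINT v|lebesgue. c *\<^sub>R (complex_of_real (h (0 + c * v))
      * exp (- (\<i> * complex_of_real (\<xi> / c * (0 + c * v))))))"
    using assms by simp
  also have "\<dots> = fourier (\<lambda>v. c * h (v * c)) \<xi>"
    unfolding fourier_def using assms
    by (intro Bochner_Integration.integral_cong) (auto simp: scaleR_conv_of_real mult_ac)
  finally show ?thesis by simp
qed

lemma two_times_one_minus_cos_le: "2 * (1 - cos x) \<le> x\<^sup>2" for x :: real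
proof -
  have "2 * (1 - cos x) = (2 * sin (x / 2))\<^sup>2"
    using cos_double_sin[of "x / 2"] by (simp add: power_mult_distrib)
  also have "\<dots> = \<bar>2 * sin (x / 2)\<bar>\<^sup>2" by simp
  also have "\<dots> \<le> \<bar>x\<bar>\<^sup>2"
    using abs_sin_x_le_abs_x[of "x / 2"] by (intro power_mono) auto
  finally show ?thesis by simp
qed

text \<open>
  Finiteness of the second moment has to be established first.  The weights \<open>2 (1 - cos (x v)) / x\<^sup>2\<close> tend to \<open>v\<^sup>2\<close>, so
  Fatou's lemma gives integrability of \<open>v\<^sup>2 h\<close>.  They are also at most \<open>v\<^sup>2\<close>, so dominated
  convergence then identifies the value.
\<close>

lemma second_moment_eq_fourier_limit:
  fixes h :: "real \<Rightarrow> real" and X :: "nat \<Rightarrow> real"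
  assumes h: "integrable lebesgue h" and nn: "AE v in lebesgue. 0 \<le> h v"
    and X: "X \<longlonglongrightarrow> 0" "\<And>n. X n \<noteq> 0"
    and lim: "(\<lambda>n. 2 * ((LINT v|lebesgue. h v) - Re (fourier h (X n))) / (X n)\<^sup>2) \<longlonglongrightarrow> E"
  shows "second_moment h = E"
proof -
  let ?F = "\<lambda>n v. 2 * (1 - cos (X n * v)) / (X n)\<^sup>2 * h v"
  have [measurable]: "h \<in> borel_measurable lebesgue" using h by auto
  have [measurable]: "(\<lambda>v. v) \<in> borel_measurable (lebesgue :: real measure)"
    by (simp add: measurable_completion)
  have cosI: "integrable lebesgue (\<lambda>v. h v * cos (X n * v))" for n
    using Re_fourier(1)[OF h, of "X n" 0] by simp
  have F_alt: "?F n = (\<lambda>v. 2 / (X n)\<^sup>2 * (h v - h v * cos (X n * v)))" for n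
    by (rule ext) (simp add: algebra_simps diff_divide_distrib)
  have FI: "integrable lebesgue (?F n)" for n
    unfolding F_alt using cosI h by simp
  have Fint: "integral\<^sup>L lebesgue (?F n) = 2 * ((LINT v|lebesgue. h v) - Re (fourier h (X n))) / (X n)\<^sup>2" for n
    unfolding F_alt using cosI h Re_fourier(2)[OF h, of "X n" 0] by simp
  have F0: "AE v in lebesgue. 0 \<le> ?F n v" for n
    using nn by eventually_elim auto
  have F_lim: "(\<lambda>n. ?F n v) \<longlonglongrightarrow> v\<^sup>2 * h v" for v
  proof -
    have "((\<lambda>x::real. 2 * (1 - cos (x * v)) / x\<^sup>2) \<longlongrightarrow> v\<^sup>2) (at 0)"
      by (real_asymp simp: power2_eq_square)
    moreover have "filterlim X (at 0) sequentially"
      using X by (simp add: filterlim_at)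
    ultimately have "(\<lambda>n. 2 * (1 - cos (X n * v)) / (X n)\<^sup>2) \<longlonglongrightarrow> v\<^sup>2"
      by (rule filterlim_compose)
    then show ?thesis by (intro tendsto_intros)
  qed
  have "(\<integral>\<^sup>+v. ennreal (v\<^sup>2 * h v) \<partial>lebesgue) = (\<integral>\<^sup>+v. liminf (\<lambda>n. ennreal (?F n v)) \<partial>lebesgue)"
    by (intro nn_integral_cong lim_imp_Liminf[symmetric] tendsto_ennrealI F_lim) simp
  also have "\<dots> \<le> liminf (\<lambda>n. \<integral>\<^sup>+v. ennreal (?F n v) \<partial>lebesgue)"
    by (rule nn_integral_liminf) measurable
  also have "\<dots> = liminf (\<lambda>n. ennreal (integral\<^sup>L lebesgue (?F n)))"
    using nn_integral_eq_integral[OF FI F0] by simp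
  also have "\<dots> = ennreal E"
    using lim unfolding Fint[symmetric] by (intro lim_imp_Liminf tendsto_ennrealI) auto
  finally have "(\<integral>\<^sup>+v. ennreal (v\<^sup>2 * h v) \<partial>lebesgue) < \<infinity>"
    by (simp add: order_le_less_trans)
  then have I2: "integrable lebesgue (\<lambda>v. v\<^sup>2 * h v)"
    using nn by (intro integrableI_nonneg) auto
  have "(\<lambda>n. integral\<^sup>L lebesgue (?F n)) \<longlonglongrightarrow> (LINT v|lebesgue. v\<^sup>2 * h v)"
  proof (rule integral_dominated_convergence[where w = "\<lambda>v. v\<^sup>2 * h v"])
    show "AE v in lebesgue. (\<lambda>n. ?F n v) \<longlonglongrightarrow> v\<^sup>2 * h v" using F_lim by simp
    fix n
    show "AE v in lebesgue. norm (?F n v) \<le> v\<^sup>2 * h v"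
      using nn
    proof eventually_elim
      case (elim v)
      have "2 * (1 - cos (X n * v)) / (X n)\<^sup>2 \<le> (X n * v)\<^sup>2 / (X n)\<^sup>2"
        by (intro divide_right_mono two_times_one_minus_cos_le) simp
      also have "\<dots> = v\<^sup>2" using X(2)[of n] by (simp add: power2_eq_square)
      finally have "?F n v \<le> v\<^sup>2 * h v" using elim by (rule mult_right_mono)
      moreover have "0 \<le> ?F n v" using elim by simp
      ultimately show ?case by (simp only: real_norm_def abs_of_nonneg)
    qed
  qed (use FI I2 in auto)
  then have "(LINT v|lebesgue. v\<^sup>2 * h v) = E"
    using lim unfolding Fint by (rule LIMSEQ_unique)
  then show ?thesis by (simp add: second_moment_def)
qed

text \<open>
  Since \<open>s > 2\<close>, the error is negligible after division by \<open>\<xi>\<^sup>2\<close>, so \<open>h\<close> has the same limit of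
  difference quotients as the Gaussian with variance \<open>E\<close>.
\<close>

lemma second_moment_of_near_gaussian:
  fixes h :: "real \<Rightarrow> real" and C E s :: real
  assumes h: "integrable lebesgue h" "AE v in lebesgue. 0 \<le> h v"
    and s: "2 < s"
    and approx: "\<And>\<xi>. norm (fourier h \<xi> - complex_of_real (exp (- (E * \<xi>\<^sup>2 / 2)))) \<le> C * \<bar>\<xi>\<bar> powr s"
  shows "second_moment h = E"
proof -
  have "fourier h 0 = 1" using approx[of 0] by simp
  then have mass: "(LINT v|lebesgue. h v) = 1"
    by (simp add: fourier_def)
  define X where "X n = inverse (real (Suc n))" for n
  have X: "X \<longlonglongrightarrow> 0" "X n > 0" for n
    unfolding X_def using LIMSEQ_inverse_real_of_nat by auto
  have X0: "X n \<noteq> 0" for n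
    using X(2)[of n] by simp
  have X_at: "filterlim X (at 0) sequentially"
    using X(1) X0 by (simp add: filterlim_at)
  let ?Q = "\<lambda>x. 2 * ((LINT v|lebesgue. h v) - Re (fourier h x)) / x\<^sup>2"
  let ?G = "\<lambda>x::real. 2 * (1 - exp (- (E * x\<^sup>2 / 2))) / x\<^sup>2"
  have G_lim: "(?G \<longlongrightarrow> E) (at 0)"
    by (real_asymp simp: power2_eq_square)
  have diff: "norm (?Q (X n) - ?G (X n)) \<le> 2 * C * X n powr (s - 2)" for n
  proof -
    have alg: "2 * (1 - r) / x - 2 * (1 - e) / x = - 2 * (r - e) / x" for r e x :: real
      by (cases "x = 0") (simp_all add: field_simps)
    have "?Q (X n) - ?G (X n)
        = - 2 * Re (fourier h (X n) - complex_of_real (exp (- (E * (X n)\<^sup>2 / 2)))) / (X n)\<^sup>2"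
      unfolding mass minus_complex.sel Re_complex_of_real by (rule alg)
    moreover have "\<bar>- 2 * r / x\<^sup>2\<bar> = 2 * \<bar>r\<bar> / x\<^sup>2" for r x :: real
      by (simp add: abs_mult)
    ultimately have "norm (?Q (X n) - ?G (X n))
        = 2 * \<bar>Re (fourier h (X n) - complex_of_real (exp (- (E * (X n)\<^sup>2 / 2))))\<bar> / (X n)\<^sup>2"
      by (simp only: real_norm_def)
    also have "\<dots> \<le> 2 * (C * \<bar>X n\<bar> powr s) / (X n)\<^sup>2"
      by (intro divide_right_mono mult_left_mono order_trans[OF abs_Re_le_cmod approx]) auto
    also have "\<dots> = 2 * C * X n powr (s - 2)"
      using X(2)[of n] by (simp add: powr_diff powr_numeral)
    finally show ?thesis .
  qed
  have "(\<lambda>n. X n powr (s - 2)) \<longlonglongrightarrow> 0 powr (s - 2)"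
    using X s by (intro tendsto_powr' tendsto_const) (auto intro!: eventuallyI less_imp_le)
  from tendsto_mult_left[OF this, of "2 * C"] have "(\<lambda>n. 2 * C * X n powr (s - 2)) \<longlonglongrightarrow> 0"
    by simp
  then have "(\<lambda>n. ?Q (X n) - ?G (X n)) \<longlonglongrightarrow> 0"
    by (rule Lim_null_comparison[OF always_eventually[OF allI[OF diff]]])
  from tendsto_add[OF this filterlim_compose[OF G_lim X_at]]
  have "(\<lambda>n. ?Q (X n)) \<longlonglongrightarrow> E"
    by (simp only: diff_add_cancel add_0_left)
  then show ?thesis
    by (rule second_moment_eq_fourier_limit[OF h X(1) X0])
qed

section \<open>Second-order expansions\<close>

text \<open>
  In each of the two remainders the small-argument bound is of second order and the large-argument bound of
  order at most one, so every power \<open>a\<close> between 1 and 2 dominates both.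
\<close>

lemma exp_remainder_le_powr:
  fixes y a :: real
  assumes "0 \<le> y" "1 \<le> a" "a \<le> 2"
  shows "exp (- y) - 1 + y \<le> y powr a" "0 \<le> exp (- y) - 1 + y" "1 - (1 + y) * exp (- y) \<le> y powr a"
    "0 \<le> 1 - (1 + y) * exp (- y)"
proof -
  have e: "1 - y \<le> exp (- y)" using exp_ge_add_one_self[of "- y"] by simp
  have e1: "(1 + y) * exp (- y) \<le> 1"
    using exp_ge_add_one_self[of y] by (simp add: exp_minus field_simps)
  show "0 \<le> exp (- y) - 1 + y" "0 \<le> 1 - (1 + y) * exp (- y)" using e e1 by auto
  have small: "y\<^sup>2 \<le> y powr a" if "y \<le> 1"
  proof (cases "y = 0")
    case False
    then have "y\<^sup>2 = y powr 2" using assms by (simp add: powr_numeral)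
    also have "\<dots> \<le> y powr a" using that assms False by (intro powr_mono') auto
    finally show ?thesis .
  qed simp
  have big: "y \<le> y powr a" if "1 \<le> y"
    using powr_mono[of 1 a y] assms that by simp
  show "1 - (1 + y) * exp (- y) \<le> y powr a"
  proof (cases "y \<le> 1")
    case True
    have "(1 + y) * (1 - y) \<le> (1 + y) * exp (- y)"
      using e assms by (intro mult_left_mono) auto
    then show ?thesis using small[OF True] by (simp add: power2_eq_square algebra_simps)
  next
    case False
    then show ?thesis using big assms by (smt (verit) exp_gt_zero mult_nonneg_nonneg)
  qed
  show "exp (- y) - 1 + y \<le> y powr a"
  proof (cases "y \<le> 1")
    case True
    have "exp (- y) \<le> 1 / (1 + y)" using e1 assms by (simp add: field_simps)
    also have "\<dots> \<le> 1 - y + y\<^sup>2"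
    proof -
      have "1 \<le> (1 - y + y\<^sup>2) * (1 + y)" using assms by (simp add: power2_eq_square algebra_simps)
      then show ?thesis using assms by (simp add: divide_le_eq)
    qed
    finally show ?thesis using small[OF True] by simp
  next
    case False
    then show ?thesis using big assms by (smt (verit) exp_le_one_iff)
  qed
qed

text \<open>
  Interpolation between the Taylor bounds of order 3 and of order 2.
\<close>

lemma iexp_second_order:
  fixes x s :: real
  assumes "2 \<le> s" "s \<le> 3"
  shows "norm (iexp x - (1 + \<i> * x - x\<^sup>2 / 2)) \<le> \<bar>x\<bar> powr s"
proof -
  have eq: "(\<Sum>k\<le>2. (\<i> * complex_of_real x) ^ k / fact k) = 1 + \<i> * x - x\<^sup>2 / 2"
  proof -
    have "{..2::nat} = {0, 1, 2}" by auto
    moreover have "(\<i> * complex_of_real x)\<^sup>2 = - (x\<^sup>2)" by (simp add: power_mult_distrib)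
    ultimately show ?thesis by simp
  qed
  show ?thesis
  proof (cases "\<bar>x\<bar> \<le> 1")
    case True
    have "norm (iexp x - (1 + \<i> * x - x\<^sup>2 / 2)) \<le> \<bar>x\<bar> ^ 3 / fact 3"
      using iexp_approx1[of x 2] unfolding eq by (simp add: eval_nat_numeral)
    also have "\<dots> \<le> \<bar>x\<bar> ^ 3" by (simp add: fact_numeral)
    also have "\<dots> \<le> \<bar>x\<bar> powr s"
    proof (cases "x = 0")
      case False
      then have "\<bar>x\<bar> ^ 3 = \<bar>x\<bar> powr 3" by (simp add: powr_numeral)
      also have "\<dots> \<le> \<bar>x\<bar> powr s" using True assms False by (intro powr_mono') auto
      finally show ?thesis .
    qed simp
    finally show ?thesis .
  next
    case False
    have "norm (iexp x - (1 + \<i> * x - x\<^sup>2 / 2)) \<le> 2 * \<bar>x\<bar> ^ 2 / fact 2"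
      using iexp_approx2[of x 2] unfolding eq .
    also have "\<dots> = \<bar>x\<bar> powr 2" using False by (simp add: powr_numeral)
    also have "\<dots> \<le> \<bar>x\<bar> powr s" using False assms by (intro powr_mono) auto
    finally show ?thesis .
  qed
qed

text \<open>
  Zero mean and unit energy make the second-order Taylor polynomial of the transform agree with that of the
  standard Gaussian; the moment of order \<open>s\<close> controls the remainder.
\<close>

lemma fourier_gaussian_initial:
  fixes g0 :: "real \<Rightarrow> real" and s \<xi> :: real
  assumes nn: "\<And>v. 0 \<le> g0 v"
    and m0: "has_bochner_integral lebesgue g0 1"
    and m1: "has_bochner_integral lebesgue (\<lambda>v. v * g0 v) 0"
    and m2: "has_bochner_integral lebesgue (\<lambda>v. v\<^sup>2 * g0 v) 1"
    and ms: "integrable lebesgue (\<lambda>v. \<bar>v\<bar> powr s * g0 v)"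
    and s: "2 \<le> s" "s \<le> 3"
  shows "norm (fourier g0 \<xi> - complex_of_real (exp (- (\<xi>\<^sup>2 / 2))))
    \<le> ((LINT v|lebesgue. \<bar>v\<bar> powr s * g0 v) + 1) * \<bar>\<xi>\<bar> powr s"
proof -
  let ?F = "\<lambda>v. complex_of_real (g0 v) * exp (- (\<i> * complex_of_real (\<xi> * v)))"
  let ?P = "\<lambda>v. complex_of_real (g0 v) - \<i> * \<xi> * complex_of_real (v * g0 v)
      - complex_of_real (\<xi>\<^sup>2 / 2) * complex_of_real (v\<^sup>2 * g0 v)"
  have c: "has_bochner_integral lebesgue (\<lambda>v. complex_of_real (h v)) (complex_of_real x)"
    if "has_bochner_integral lebesgue h x" for h :: "real \<Rightarrow> real" and x
    using that by (rule has_bochner_integral_of_real)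
  have P: "has_bochner_integral lebesgue ?P (complex_of_real 1 - \<i> * \<xi> * complex_of_real 0
      - complex_of_real (\<xi>\<^sup>2 / 2) * complex_of_real 1)"
    by (intro has_bochner_integral_diff has_bochner_integral_mult_right c m0 m1 m2)
  have F: "integrable lebesgue ?F"
    using m0 by (intro fourier_integrand_integrable) (auto simp: has_bochner_integral_iff)
  have FP: "integrable lebesgue (\<lambda>v. ?F v - ?P v)"
    by (rule Bochner_Integration.integrable_diff[OF F integrable.intros[OF P]])
  have eq: "fourier g0 \<xi> - (1 - \<xi>\<^sup>2 / 2) = (LINT v|lebesgue. ?F v - ?P v)"
    using P F by (simp add: fourier_def has_bochner_integral_iff)
  have "norm (fourier g0 \<xi> - (1 - \<xi>\<^sup>2 / 2)) \<le> (LINT v|lebesgue. norm (?F v - ?P v))"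
    unfolding eq by (rule integral_norm_bound)
  also have "\<dots> \<le> (LINT v|lebesgue. \<bar>\<xi>\<bar> powr s * (\<bar>v\<bar> powr s * g0 v))"
  proof (rule integral_mono)
    show "integrable lebesgue (\<lambda>v. norm (?F v - ?P v))"
      using FP by (rule integrable_norm)
    show "integrable lebesgue (\<lambda>v. \<bar>\<xi>\<bar> powr s * (\<bar>v\<bar> powr s * g0 v))"
      using ms by simp
    fix v
    let ?x = "- (\<xi> * v)"
    have "?F v - ?P v = complex_of_real (g0 v) * (iexp ?x - (1 + \<i> * ?x - ?x\<^sup>2 / 2))"
      by (simp add: algebra_simps power2_eq_square)
    then have "norm (?F v - ?P v) = g0 v * norm (iexp ?x - (1 + \<i> * ?x - ?x\<^sup>2 / 2))"
      using nn[of v] by (simp only: norm_mult norm_of_real abs_of_nonneg)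
    also have "\<dots> \<le> g0 v * \<bar>?x\<bar> powr s"
      using iexp_second_order[OF s, of ?x] nn[of v] by (rule mult_left_mono)
    finally show "norm (?F v - ?P v) \<le> \<bar>\<xi>\<bar> powr s * (\<bar>v\<bar> powr s * g0 v)"
      by (simp add: abs_mult powr_mult mult_ac)
  qed
  finally have 1: "norm (fourier g0 \<xi> - (1 - \<xi>\<^sup>2 / 2)) \<le> \<bar>\<xi>\<bar> powr s * (LINT v|lebesgue. \<bar>v\<bar> powr s * g0 v)"
    by simp
  let ?y = "\<xi>\<^sup>2 / 2"
  have "\<bar>exp (- ?y) - 1 + ?y\<bar> \<le> ?y powr (s / 2)"
    using exp_remainder_le_powr[of ?y "s / 2"] s by simp
  also have "\<dots> \<le> (\<bar>\<xi>\<bar>\<^sup>2) powr (s / 2)"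
    using s by (intro powr_mono2) auto
  also have "\<dots> = \<bar>\<xi>\<bar> powr s"
  proof -
    have "\<bar>\<xi>\<bar>\<^sup>2 = \<bar>\<xi>\<bar> powr 2" by (simp add: powr_numeral)
    then show ?thesis by (simp only: powr_powr) simp
  qed
  finally have "norm (complex_of_real (exp (- ?y) - 1 + ?y)) \<le> \<bar>\<xi>\<bar> powr s"
    by (simp only: norm_of_real)
  then have 2: "norm ((1 - \<xi>\<^sup>2 / 2) - complex_of_real (exp (- ?y))) \<le> \<bar>\<xi>\<bar> powr s"
    by (subst norm_minus_commute) (simp add: algebra_simps)
  show ?thesis
    using norm_triangle_le[OF add_mono[OF 1 2]] by (simp add: algebra_simps)
qed

section \<open>Closeness of the solution to the Gaussian\<close>

lemma weak_solution_norm_le_mass: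
  assumes "weak_solution p q g0 f" and "0 \<le> t"
  shows "norm (fourier (f t) \<xi>) \<le> Re (fourier (f t) 0)" and "fourier (f t) 0 = complex_of_real (Re (fourier (f t) 0))"
proof -
  have int: "integrable lebesgue (f t)" and nn: "AE v in lebesgue. 0 \<le> f t v"
    using assms unfolding weak_solution_def C1_L1_def by auto
  have f0: "fourier (f t) 0 = complex_of_real (LINT v|lebesgue. f t v)"
    unfolding fourier_def by simp
  then show "norm (fourier (f t) \<xi>) \<le> Re (fourier (f t) 0)"
    using norm_fourier_le_integral[OF int nn] by simp
  show "fourier (f t) 0 = complex_of_real (Re (fourier (f t) 0))"
    by (simp add: f0)
qed

text \<open>
  The mass \<open>m\<close> satisfies \<open>m' = m (m - 1)\<close> and starts at the stationary value 1.  If \<open>M\<close> bounds \<open>m\<close> on the time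
  interval, then \<open>(m - 1)\<^sup>2 exp (- 2 M t)\<close> is nonincreasing, nonnegative and initially 0.
\<close>

lemma weak_solution_mass:
  assumes ws: "weak_solution p q g0 f" and init: "fourier g0 0 = 1" and "0 \<le> T"
  shows "fourier (f T) 0 = 1"
proof -
  define m where "m t = Re (fourier (f t) 0)" for t
  have m': "((\<lambda>s. fourier (f s) 0) has_vector_derivative
      (fourier (f t) 0 * fourier (f t) 0 - fourier (f t) 0)) (at t within {0..})" if "0 \<le> t" for t
  proof -
    have "((\<lambda>s. fourier (f s) 0) has_vector_derivative
        (fourier (f t) (p * 0) * fourier (f t) (q * 0) - fourier (f t) 0)) (at t within {0..})"
      using ws that unfolding weak_solution_def by blast
    then show ?thesis by simp
  qed
  have dm: "(m has_real_derivative (m t * (m t - 1))) (at t within {0..})" if "0 \<le> t" for t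
  proof -
    have re: "fourier (f t) 0 = complex_of_real (m t)"
      using weak_solution_norm_le_mass(2)[OF ws that] by (simp add: m_def)
    have "((\<lambda>s. Re (fourier (f s) 0)) has_vector_derivative
        Re (fourier (f t) 0 * fourier (f t) 0 - fourier (f t) 0)) (at t within {0..})"
      using bounded_linear.has_vector_derivative[OF bounded_linear_Re m'[OF that]] .
    then show ?thesis
      unfolding has_real_derivative_iff_has_vector_derivative m_def[symmetric]
      by (simp add: re algebra_simps)
  qed
  have cont: "continuous_on {0..T} m"
  proof (rule continuous_on_subset)
    show "continuous_on {0..} m"
      unfolding continuous_on_eq_continuous_within
      using dm DERIV_continuous by blast
  qed auto
  have "compact (m ` {0..T})"
    by (intro compact_continuous_image cont) auto
  then have "bounded (m ` {0..T})" by (rule compact_imp_bounded)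
  then obtain M where M: "\<And>t. 0 \<le> t \<Longrightarrow> t \<le> T \<Longrightarrow> \<bar>m t\<bar> \<le> M"
    unfolding bounded_iff by fastforce
  let ?G = "\<lambda>t. (m t - 1)\<^sup>2 * exp (- 2 * M * t)"
  have "?G T \<le> ?G 0"
  proof (rule DERIV_nonpos_imp_decreasing_open[OF \<open>0 \<le> T\<close>])
    show "continuous_on {0..T} ?G" by (intro continuous_intros cont)
    fix t assume t: "0 < t" "t < T"
    have "at t within {0..} = at t" using t by (intro at_within_interior) auto
    then have d: "(m has_real_derivative (m t * (m t - 1))) (at t)" using dm[of t] t by simp
    have "(?G has_real_derivative (2 * (m t - 1)\<^sup>2 * exp (- 2 * M * t) * (m t - M))) (at t)"
      by (rule derivative_eq_intros d refl | simp add: power2_eq_square algebra_simps)+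
    moreover have "2 * (m t - 1)\<^sup>2 * exp (- 2 * M * t) * (m t - M) \<le> 0"
      using M[of t] t by (intro mult_nonneg_nonpos) auto
    ultimately show "\<exists>y. (?G has_real_derivative y) (at t) \<and> y \<le> 0" by blast
  qed
  moreover have "m 0 = 1"
    using ws init unfolding weak_solution_def m_def by simp
  ultimately have "(m T - 1)\<^sup>2 * exp (- 2 * M * T) \<le> 0" by simp
  then have "m T = 1" by (simp add: mult_le_0_iff)
  then show ?thesis
    using weak_solution_norm_le_mass(2)[OF ws \<open>0 \<le> T\<close>] by (simp add: m_def)
qed

text \<open>
  The hypothesis on \<open>K\<close> makes \<open>K \<bar>\<xi>\<bar> powr s exp (- b s t)\<close> a supersolution of the equation for the
  difference to the Gaussian.  A priori the weighted supremum of that difference could be infinite for \<open>t > 0\<close>, so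
  a Gronwall argument for it is not available.  Instead the trivial bound 2 is improved iteratively: each
  step replaces the excess \<open>2 (2 t) ^ n / n!\<close> over the supersolution by the next term of the
  exponential series, and the excess tends to 0.
\<close>

lemma weak_solution_near_gaussian:
  fixes p q s K b \<xi> t :: real
  assumes ws: "weak_solution p q g0 f" and mass: "fourier g0 0 = 1"
    and pq: "0 < p" "0 < q" and b: "b = (1 - p\<^sup>2 - q\<^sup>2) / 2" "0 < b"
    and s: "2 \<le> s" "s \<le> 4"
    and K: "K * (p powr s + q powr s) + 1 \<le> K * (1 - b * s)" "0 \<le> K"
    and init: "\<And>\<xi>. norm (fourier g0 \<xi> - complex_of_real (exp (- (\<xi>\<^sup>2 / 2)))) \<le> K * \<bar>\<xi>\<bar> powr s"
    and "0 \<le> t"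
  shows "norm (fourier (f t) \<xi> - complex_of_real (exp (- (exp (- (2 * b * t)) * \<xi>\<^sup>2 / 2))))
    \<le> K * (\<bar>\<xi>\<bar> powr s * exp (- (b * s * t)))"
proof -
  define G where "G \<xi> t = exp (- (exp (- (2 * b * t)) * \<xi>\<^sup>2 / 2))" for \<xi> t
  define A where "A \<xi> t = \<bar>\<xi>\<bar> powr s * exp (- (b * s * t))" for \<xi> t
  define w where "w \<xi> t = fourier (f t) \<xi> - complex_of_real (G \<xi> t)" for \<xi> t
  have A0: "0 \<le> A \<xi> t" for \<xi> t by (simp add: A_def)
  have \<phi>1: "norm (fourier (f t) \<xi>) \<le> 1" if "0 \<le> t" for \<xi> t
    using weak_solution_norm_le_mass(1)[OF ws that, of \<xi>] weak_solution_mass[OF ws mass that] by simp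
  have "0 \<le> p\<^sup>2" "0 \<le> q\<^sup>2" by simp_all
  then have b1: "b \<le> 1" unfolding b(1) by (smt (verit) zero_le_power2 divide_le_eq_1)
  have G1: "norm (complex_of_real (G \<xi> t)) \<le> 1" for \<xi> t
    by (simp add: G_def)
  have bound: "norm (w \<xi> t) \<le> K * A \<xi> t + 2 * (2 * t) ^ n / fact n" if "0 \<le> t" for n \<xi> t
    using that
  proof (induction n arbitrary: \<xi> t)
    case 0
    have "norm (w \<xi> t) \<le> norm (fourier (f t) \<xi>) + norm (complex_of_real (G \<xi> t))"
      unfolding w_def by (rule norm_triangle_ineq4)
    also have "\<dots> \<le> 2" using \<phi>1[OF 0, of \<xi>] G1[of \<xi> t] by simp
    finally show ?case using mult_nonneg_nonneg[OF K(2) A0[of \<xi> t]] by simp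
  next
    case (Suc n)
    let ?\<phi> = "\<lambda>\<xi> t. fourier (f t) \<xi>"
    let ?X = "\<lambda>t. exp (- (2 * b * t)) * \<xi>\<^sup>2"
    \<comment> \<open>The second term of \<open>?N\<close> is the time derivative of \<open>G\<close> plus \<open>G\<close>, so that \<open>w' = ?N - w\<close>.\<close>
    let ?N = "\<lambda>t. ?\<phi> (p * \<xi>) t * ?\<phi> (q * \<xi>) t - complex_of_real ((1 + b * ?X t) * G \<xi> t)"
    let ?H = "\<lambda>t. K * A \<xi> t + 2 * (2 * t) ^ Suc n / fact (Suc n)"
    let ?H' = "\<lambda>t. - (b * s) * K * A \<xi> t + 4 * (2 * t) ^ n / fact n"
    show ?case
    proof (rule norm_le_supersolution[OF Suc.prems, where N = ?N and H' = ?H'])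
      fix t :: real assume t: "0 \<le> t"
      have dG: "(G \<xi> has_real_derivative b * ?X t * G \<xi> t) (at t within {0..})"
        unfolding G_def
        by (rule derivative_eq_intros refl | simp add: algebra_simps)+
      have "((\<lambda>s. ?\<phi> \<xi> s) has_vector_derivative
        (?\<phi> (p * \<xi>) t * ?\<phi> (q * \<xi>) t - ?\<phi> \<xi> t)) (at t within {0..})"
        using ws t unfolding weak_solution_def by blast
      from has_vector_derivative_diff[OF this has_vector_derivative_of_real[OF dG]]
      show "(w \<xi> has_vector_derivative (?N t - w \<xi> t)) (at t within {0..})"
        unfolding w_def by (simp add: algebra_simps)
      show "(?H has_real_derivative ?H' t) (at t)"
      proof -
        have "((\<lambda>t. 2 * (2 * t) ^ Suc n / fact (Suc n)) has_real_derivative 4 * (2 * t) ^ n / fact n) (at t)"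
          by (rule derivative_eq_intros refl | simp add: field_simps del: of_nat_Suc)+
        moreover have "((\<lambda>t. K * A \<xi> t) has_real_derivative - (b * s) * K * A \<xi> t) (at t)"
          unfolding A_def by (rule derivative_eq_intros refl | simp add: algebra_simps)+
        ultimately show ?thesis by (rule DERIV_add[rotated])
      qed
      let ?y = "b * ?X t"
      let ?c = "\<lambda>\<xi>. complex_of_real (G \<xi> t)"
      have y0: "0 \<le> ?y" using b by simp
      have prodchi: "G (p * \<xi>) t * G (q * \<xi>) t = G \<xi> t * exp ?y"
        unfolding G_def b(1) exp_add[symmetric] by (simp add: field_simps power2_eq_square)
      \<comment> \<open>The residual of the Gaussian is of second order in \<open>?y\<close> and at most 1, hence at most \<open>?y powr (s / 2)\<close>.\<close>
      have res_eq: "G (p * \<xi>) t * G (q * \<xi>) t - (1 + ?y) * G \<xi> t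
          = G (p * \<xi>) t * G (q * \<xi>) t * (1 - (1 + ?y) * exp (- ?y))"
        unfolding prodchi by (simp add: exp_minus field_simps)
      have "\<bar>G (p * \<xi>) t * G (q * \<xi>) t - (1 + ?y) * G \<xi> t\<bar> \<le> 1 * ?y powr (s / 2)"
        unfolding res_eq abs_mult
        using G1[of "p * \<xi>" t] G1[of "q * \<xi>" t] exp_remainder_le_powr(3,4)[OF y0, of "s / 2"] s
        by (intro mult_mono mult_le_one) (auto simp: G_def)
      also have "\<dots> \<le> (?X t) powr (s / 2)"
        using y0 b b1 s mult_right_mono[of b 1 "?X t"] by (auto intro!: powr_mono2)
      also have "\<dots> = A \<xi> t"
      proof (cases "\<xi> = 0")
        case False
        have "(?X t) powr (s / 2) = exp (- (2 * b * t)) powr (s / 2) * (\<bar>\<xi>\<bar> powr 2) powr (s / 2)"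
          by (simp add: powr_mult powr_numeral False)
        then show ?thesis
          unfolding A_def by (simp add: powr_powr exp_powr_real algebra_simps del: powr_numeral)
      qed (simp add: A_def)
      finally have res: "\<bar>G (p * \<xi>) t * G (q * \<xi>) t - (1 + ?y) * G \<xi> t\<bar> \<le> A \<xi> t" .
      have Nsplit: "?N t = w (p * \<xi>) t * ?\<phi> (q * \<xi>) t + ?c (p * \<xi>) * w (q * \<xi>) t
          + complex_of_real (G (p * \<xi>) t * G (q * \<xi>) t - (1 + ?y) * G \<xi> t)"
        unfolding w_def by (simp add: algebra_simps)
      have "norm (?N t) \<le> norm (w (p * \<xi>) t * ?\<phi> (q * \<xi>) t) + norm (?c (p * \<xi>) * w (q * \<xi>) t) + A \<xi> t"
        unfolding Nsplit
        by (intro norm_triangle_mono order_refl) (simp only: norm_of_real res)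
      also have "\<dots> \<le> norm (w (p * \<xi>) t) + norm (w (q * \<xi>) t) + A \<xi> t"
        using \<phi>1[OF t, of "q * \<xi>"] G1[of "p * \<xi>" t] unfolding norm_mult
        by (intro add_mono order_refl mult_right_le_one_le mult_left_le_one_le) auto
      also have "\<dots> \<le> (K * A (p * \<xi>) t + 2 * (2 * t) ^ n / fact n)
          + (K * A (q * \<xi>) t + 2 * (2 * t) ^ n / fact n) + A \<xi> t"
        using Suc.IH[OF t] by (intro add_mono) auto
      also have "\<dots> = (K * (p powr s + q powr s) + 1) * A \<xi> t + 4 * (2 * t) ^ n / fact n"
        using pq by (simp add: A_def abs_mult powr_mult algebra_simps)
      also have "\<dots> \<le> (K * (1 - b * s)) * A \<xi> t + 4 * (2 * t) ^ n / fact n"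
        using mult_right_mono[OF K(1) A0[of \<xi> t]] by simp
      also have "\<dots> \<le> ?H' t + ?H t"
        using t by (simp add: algebra_simps)
      finally show "norm (?N t) \<le> ?H' t + ?H t" .
    next
      have "fourier (f 0) \<xi> = fourier g0 \<xi>"
        using ws unfolding weak_solution_def by blast
      then show "norm (w \<xi> 0) \<le> ?H 0"
        using init[of \<xi>] by (simp add: w_def G_def A_def)
    qed
  qed
  have "(\<lambda>n. K * A \<xi> t + 2 * (inverse (fact n) * (2 * t) ^ n)) \<longlonglongrightarrow> K * A \<xi> t + 2 * 0"
    by (intro tendsto_intros summable_LIMSEQ_zero summable_exp)
  moreover have "norm (w \<xi> t) \<le> K * A \<xi> t + 2 * (inverse (fact n) * (2 * t) ^ n)" for n
    using bound[OF \<open>0 \<le> t\<close>, of \<xi> n] by (simp add: field_simps)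
  ultimately have "norm (w \<xi> t) \<le> K * A \<xi> t + 2 * 0"
    by (intro LIMSEQ_le_const) auto
  then show ?thesis by (simp add: w_def G_def A_def)
qed

section \<open>The envelope\<close>

text \<open>
  The two pieces need not match at \<open>\<rho>\<close>: comparison is done only while the scaled frequency exceeds \<open>\<rho>\<close>.
\<close>

definition envelope :: "real \<Rightarrow> real \<Rightarrow> real \<Rightarrow> real \<Rightarrow> real \<Rightarrow> real" where
  "envelope \<rho> k c \<nu> \<eta> = (if \<eta> \<le> \<rho> then 1 / (1 + k * \<eta>\<^sup>2) else c * (\<eta> / \<rho>) powr (- \<nu>))"

text \<open>
  The loss \<open>q powr (- \<nu>)\<close> from evaluating the power tail at \<open>q \<eta>\<close> or \<open>p \<eta>\<close> instead of \<open>\<eta>\<close> must be paid by the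
  second factor: by the value of the core at or beyond \<open>q \<rho>\<close> if one argument lies below \<open>\<rho>\<close>, and by \<open>c\<close> if both
  lie above.  These are the two conditions on \<open>c\<close> and \<open>\<nu>\<close>.
\<close>

lemma envelope_product_le:
  fixes \<rho> k c \<nu> p q \<eta> :: real
  assumes pos: "0 < \<rho>" "0 < k" "0 < c" "0 < \<nu>"
    and pq: "0 < q" "q \<le> p" "p < 1"
    and core: "1 / (1 + k * (q * \<rho>)\<^sup>2) \<le> c * q powr \<nu>" and tail: "c \<le> q powr \<nu>"
    and \<eta>: "\<rho> < \<eta>"
  shows "envelope \<rho> k c \<nu> (p * \<eta>) * envelope \<rho> k c \<nu> (q * \<eta>) \<le> envelope \<rho> k c \<nu> \<eta>"
proof -
  define \<theta> where "\<theta> = 1 / (1 + k * (q * \<rho>)\<^sup>2)"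
  define e where "e = (\<eta> / \<rho>) powr (- \<nu>)"
  have e0: "0 < e" unfolding e_def using pos \<eta> by simp
  have target: "envelope \<rho> k c \<nu> \<eta> = c * e"
    unfolding envelope_def e_def using \<eta> by simp
  have \<theta>0: "0 < \<theta>" unfolding \<theta>_def using pos by (intro divide_pos_pos add_pos_nonneg) auto
  have inside: "0 < envelope \<rho> k c \<nu> (r * \<eta>) \<and> envelope \<rho> k c \<nu> (r * \<eta>) \<le> \<theta>"
    if "q \<le> r" "r * \<eta> \<le> \<rho>" for r
  proof -
    have "q * \<rho> \<le> r * \<eta>" using that pq pos \<eta> by (intro mult_mono) auto
    then have "(q * \<rho>)\<^sup>2 \<le> (r * \<eta>)\<^sup>2" using pq pos by (intro power_mono) auto
    then have le: "1 + k * (q * \<rho>)\<^sup>2 \<le> 1 + k * (r * \<eta>)\<^sup>2" using pos by simp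
    have "0 < 1 + k * (q * \<rho>)\<^sup>2" using pos by (intro add_pos_nonneg) auto
    then show ?thesis unfolding envelope_def \<theta>_def using that le by (auto intro!: divide_left_mono)
  qed
  have outside: "envelope \<rho> k c \<nu> (r * \<eta>) = c * (r powr (- \<nu>) * e)" if "0 < r" "\<rho> < r * \<eta>" for r
    unfolding envelope_def e_def using that pos \<eta> powr_mult[of r "\<eta> / \<rho>" "- \<nu>"] by simp
  have c1: "c \<le> 1"
    using tail powr_le1[of \<nu> q] pq pos by linarith
  consider (both_in) "p * \<eta> \<le> \<rho>" "q * \<eta> \<le> \<rho>" | (one_in) "\<rho> < p * \<eta>" "q * \<eta> \<le> \<rho>"
    | (none_in) "\<rho> < p * \<eta>" "\<rho> < q * \<eta>"
    using pq pos \<eta> mult_right_mono[of q p \<eta>] by linarith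
  then show ?thesis
  proof cases
    case both_in
    have "1 \<le> 1 + k * (q * \<rho>)\<^sup>2" using pos by simp
    then have "\<theta> \<le> 1 / 1" unfolding \<theta>_def by (intro frac_le) auto
    then have "\<theta> \<le> 1" by simp
    then have "envelope \<rho> k c \<nu> (p * \<eta>) * envelope \<rho> k c \<nu> (q * \<eta>) \<le> 1 * \<theta>"
      using inside[of p] inside[of q] both_in pq by (intro mult_mono) auto
    also have "\<dots> \<le> c * q powr \<nu>" using core by (simp add: \<theta>_def)
    also have "q powr \<nu> \<le> e"
    proof -
      have "\<eta> / \<rho> \<le> 1 / q" using both_in pq pos by (simp add: field_simps)
      then have "(1 / q) powr (- \<nu>) \<le> e"
        unfolding e_def using pos \<eta> by (intro powr_mono2') auto
      then show ?thesis using pq by (simp add: powr_minus powr_divide)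
    qed
    finally show ?thesis using pos by (simp add: target)
  next
    case one_in
    have "envelope \<rho> k c \<nu> (p * \<eta>) * envelope \<rho> k c \<nu> (q * \<eta>) \<le> (c * (p powr (- \<nu>) * e)) * \<theta>"
      using outside[of p] inside[of q] one_in pq pos e0 by (simp add: mult_left_mono)
    also have "\<dots> = (\<theta> * p powr (- \<nu>)) * (c * e)" by simp
    also have "\<dots> \<le> 1 * (c * e)"
    proof (rule mult_right_mono)
      have "\<theta> \<le> c * q powr \<nu>" using core by (simp add: \<theta>_def)
      also have "\<dots> \<le> 1 * p powr \<nu>" using c1 pos pq by (intro mult_mono powr_mono2) auto
      finally show "\<theta> * p powr (- \<nu>) \<le> 1" using pq by (simp add: powr_minus field_simps)
    qed (use pos e0 in auto)
    finally show ?thesis by (simp add: target)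
  next
    case none_in
    have "envelope \<rho> k c \<nu> (p * \<eta>) \<le> c"
    proof -
      have "(p * \<eta> / \<rho>) powr (- \<nu>) \<le> 1 powr (- \<nu>)"
        using none_in pos by (intro powr_mono2') (auto simp: field_simps)
      then show ?thesis using none_in pos by (simp add: envelope_def)
    qed
    then have "envelope \<rho> k c \<nu> (p * \<eta>) * envelope \<rho> k c \<nu> (q * \<eta>) \<le> c * (c * (q powr (- \<nu>) * e))"
      using outside[of q] none_in pq pos e0 by (simp add: mult_right_mono)
    also have "\<dots> = (c * q powr (- \<nu>)) * (c * e)" by simp
    also have "\<dots> \<le> 1 * (c * e)"
      using tail pq pos e0 by (intro mult_right_mono) (auto simp: powr_minus field_simps)
    finally show ?thesis by (simp add: target)
  qed
qed

text \<open>
  Besides \<open>0 < \<nu> < \<nu>0 / 2\<close>, all requirements on \<open>\<nu>\<close> have the form \<open>x < c * a powr \<nu>\<close> with \<open>x < c\<close>, or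
  \<open>c < a powr \<nu>\<close> with \<open>c < 1\<close>, so they
  hold for all small positive \<open>\<nu>\<close>.  It is therefore enough to take \<open>c\<close> between 1 and the three numbers that must
  stay below it: \<open>\<theta>\<close>, the maximum of \<open>\<bar>h\<bar>\<close> over \<open>\<rho> \<le> \<bar>\<xi>\<bar> \<le> R\<close>, and a value \<open>m1\<close> of the decaying bound.
\<close>

lemma envelope_parameters:
  fixes h :: "real \<Rightarrow> complex" and q \<rho> \<theta> R \<beta> \<nu>0 :: real
  assumes pos: "0 < q" "0 < \<rho>" "0 < R" "0 < \<beta>" "0 < \<nu>0"
    and \<theta>: "0 < \<theta>" "\<theta> < 1"
    and cont: "continuous_on UNIV h" and less: "\<And>\<xi>. \<xi> \<noteq> 0 \<Longrightarrow> norm (h \<xi>) < 1"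
    and decay: "\<And>\<xi>. R < \<bar>\<xi>\<bar> \<Longrightarrow> norm (h \<xi>) \<le> 1 / (1 + \<beta> * \<bar>\<xi>\<bar>) powr \<nu>0"
  obtains c \<nu> where "0 < c" "c < 1" "0 < \<nu>" "\<theta> \<le> c * q powr \<nu>" "c \<le> q powr \<nu>"
    "\<And>\<xi>. \<rho> < \<bar>\<xi>\<bar> \<Longrightarrow> norm (h \<xi>) \<le> c * (\<bar>\<xi>\<bar> / \<rho>) powr (- \<nu>)"
proof -
  let ?C = "{\<xi>::real. \<rho> \<le> \<bar>\<xi>\<bar> \<and> \<bar>\<xi>\<bar> \<le> R}"
  obtain m0 where m0: "0 \<le> m0" "m0 < 1" "\<And>\<xi>. \<xi> \<in> ?C \<Longrightarrow> norm (h \<xi>) \<le> m0"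
  proof (cases "?C = {}")
    case True
    then show ?thesis using that[of 0] by auto
  next
    case False
    have "?C = {-R..-\<rho>} \<union> {\<rho>..R}" using pos by auto
    then have "compact ?C" by (simp add: compact_Un)
    moreover have "continuous_on ?C (\<lambda>\<xi>. norm (h \<xi>))"
      by (intro continuous_on_norm continuous_on_subset[OF cont]) auto
    ultimately obtain x where x: "x \<in> ?C" "\<forall>y\<in>?C. norm (h y) \<le> norm (h x)"
      using continuous_attains_sup[OF _ False] by blast
    then show ?thesis using that[of "norm (h x)"] less[of x] pos by auto
  qed
  \<comment> \<open>Only half of the exponent \<open>\<nu>0\<close> is spent on smallness; the other half leaves room for the decay \<open>\<nu>\<close>.\<close>
  define B where "B = 1 + \<beta> * R"
  define m1 where "m1 = B powr (- (\<nu>0 / 2))"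
  have "1 < B" unfolding B_def using pos by simp
  then have m1: "m1 < 1"
    unfolding m1_def using pos powr_less_mono[of "- (\<nu>0 / 2)" 0 B] by simp
  define c where "c = (1 + max \<theta> (max m0 m1)) / 2"
  have c: "\<theta> < c" "m0 < c" "m1 < c" "0 < c" "c < 1"
    unfolding c_def using \<theta> m0 m1 by auto
  have lim: "((\<lambda>\<nu>. a powr \<nu>) \<longlongrightarrow> 1) (at_right 0)" if "0 < a" for a :: real
  proof -
    have "((\<lambda>\<nu>. a powr \<nu>) \<longlongrightarrow> a powr 0) (at_right 0)"
      using that by (intro tendsto_intros) auto
    then show ?thesis using that by simp
  qed
  have lim_c: "((\<lambda>\<nu>. c * a powr \<nu>) \<longlongrightarrow> c) (at_right 0)" if "0 < a" for a :: real
    using tendsto_mult_left[OF lim[OF that], of c] by simp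
  have "eventually (\<lambda>\<nu>. 0 < \<nu> \<and> \<nu> < \<nu>0 / 2 \<and> \<theta> < c * q powr \<nu> \<and> c < q powr \<nu>
      \<and> m0 < c * (\<rho> / R) powr \<nu> \<and> m1 < c * (\<beta> * \<rho>) powr \<nu>) (at_right 0)"
    using pos c
    by (intro eventually_conj order_tendstoD(1)[OF lim_c] order_tendstoD(1)[OF lim])
       (auto simp: eventually_at_right_less eventually_at_right_field intro!: exI[of _ "\<nu>0 / 2"])
  then obtain \<nu> where \<nu>: "0 < \<nu>" "\<nu> < \<nu>0 / 2" "\<theta> < c * q powr \<nu>" "c < q powr \<nu>"
      "m0 < c * (\<rho> / R) powr \<nu>" "m1 < c * (\<beta> * \<rho>) powr \<nu>"
    using eventually_happens[of _ "at_right (0::real)"] trivial_limit_at_right_real by blast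
  have bound: "norm (h \<xi>) \<le> c * (\<bar>\<xi>\<bar> / \<rho>) powr (- \<nu>)" if \<xi>: "\<rho> < \<bar>\<xi>\<bar>" for \<xi>
  proof (cases "\<bar>\<xi>\<bar> \<le> R")
    case True
    have "norm (h \<xi>) \<le> m0" using m0(3)[of \<xi>] \<xi> True by simp
    also have "\<dots> \<le> c * (\<rho> / R) powr \<nu>" using \<nu>(5) by simp
    also have "\<dots> \<le> c * (\<rho> / \<bar>\<xi>\<bar>) powr \<nu>"
      using True \<xi> pos c \<nu> by (intro mult_left_mono powr_mono2 divide_left_mono) auto
    also have "\<dots> = c * (\<bar>\<xi>\<bar> / \<rho>) powr (- \<nu>)"
      using \<xi> pos by (simp add: powr_minus powr_divide)
    finally show ?thesis .
  next
    case False
    then have R: "R < \<bar>\<xi>\<bar>" by simp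
    let ?x = "1 + \<beta> * \<bar>\<xi>\<bar>"
    have "norm (h \<xi>) \<le> ?x powr (- \<nu>0)"
      using decay[OF R] by (simp add: powr_minus divide_inverse)
    also have "\<dots> = ?x powr (- \<nu>) * ?x powr (- (\<nu>0 - \<nu>))"
      by (simp add: powr_add[symmetric])
    also have "\<dots> \<le> (\<beta> * \<bar>\<xi>\<bar>) powr (- \<nu>) * m1"
    proof (rule mult_mono)
      show "?x powr (- \<nu>) \<le> (\<beta> * \<bar>\<xi>\<bar>) powr (- \<nu>)"
        using pos R \<nu> by (intro powr_mono2') auto
      have "?x powr (- (\<nu>0 - \<nu>)) \<le> ?x powr (- (\<nu>0 / 2))"
        using pos \<nu> by (intro powr_mono) auto
      also have "\<dots> \<le> m1"
        unfolding m1_def B_def using pos R by (intro powr_mono2') (auto intro!: add_pos_pos)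
      finally show "?x powr (- (\<nu>0 - \<nu>)) \<le> m1" .
    qed auto
    also have "\<dots> \<le> (\<beta> * \<bar>\<xi>\<bar>) powr (- \<nu>) * (c * (\<beta> * \<rho>) powr \<nu>)"
      using \<nu> by (intro mult_left_mono) auto
    also have "\<dots> = c * (\<bar>\<xi>\<bar> / \<rho>) powr (- \<nu>)"
      using pos \<xi> by (simp add: powr_mult powr_divide powr_minus field_simps)
    finally show ?thesis .
  qed
  show thesis using that[OF c(4,5) \<nu>(1)] \<nu>(3,4) bound by auto
qed

text \<open>
  The gap between \<open>1 / (1 + \<eta>\<^sup>2 / 2)\<close> and \<open>1 / (1 + \<eta>\<^sup>2 / 4)\<close> is at least \<open>\<eta>\<^sup>2 / 8\<close> for \<open>\<eta> \<le> 1\<close>, and this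
  absorbs the error of order \<open>2 + \<delta>\<close>.
\<close>

lemma gaussian_core_bound:
  fixes \<eta> \<rho> K \<delta> :: real
  assumes "0 < \<delta>" and "0 \<le> K" and "K * \<rho> powr \<delta> \<le> 1 / 8" and "\<rho> \<le> 1" and "0 \<le> \<eta>" "\<eta> \<le> \<rho>"
  shows "exp (- (\<eta>\<^sup>2 / 2)) + K * \<eta> powr (2 + \<delta>) \<le> 1 / (1 + (1 / 4) * \<eta>\<^sup>2)"
proof -
  define y where "y = \<eta>\<^sup>2"
  have y: "0 \<le> y" "y \<le> 1" unfolding y_def using assms by (auto simp: power_le_one)
  have "exp (- (y / 2)) \<le> 1 / (1 + y / 2)"
    using exp_ge_add_one_self[of "y / 2"] y by (simp add: exp_minus field_simps)
  moreover have "K * \<eta> powr (2 + \<delta>) \<le> y / 8"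
  proof -
    have "K * \<eta> powr (2 + \<delta>) = y * (K * \<eta> powr \<delta>)"
      unfolding y_def using assms by (cases "\<eta> = 0") (auto simp: powr_add powr_numeral)
    also have "\<dots> \<le> y * (K * \<rho> powr \<delta>)"
      using assms y by (intro mult_left_mono powr_mono2) auto
    also have "\<dots> \<le> y * (1 / 8)" using assms y by (intro mult_left_mono) auto
    finally show ?thesis by simp
  qed
  moreover have "1 / (1 + y / 2) + y / 8 \<le> 1 / (1 + y / 4)"
  proof -
    have "(1 + y / 2) * (1 + y / 4) \<le> (1 + 1 / 2) * (1 + 1 / 4)"
      using y by (intro mult_mono) auto
    then have "(1 + y / 2) * (1 + y / 4) \<le> 2" by simp
    then have "(y / 8) * ((1 + y / 2) * (1 + y / 4)) \<le> (y / 8) * 2"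
      using y by (intro mult_left_mono) auto
    moreover have "1 / (1 + y / 4) - 1 / (1 + y / 2) = (y / 4) / ((1 + y / 2) * (1 + y / 4))"
      using y by (simp add: field_simps)
    moreover have "0 < (1 + y / 2) * (1 + y / 4)" using y by (intro mult_pos_pos) auto
    ultimately have "y / 8 \<le> 1 / (1 + y / 4) - 1 / (1 + y / 2)"
      by (simp add: pos_le_divide_eq)
    then show ?thesis by simp
  qed
  ultimately show ?thesis by (simp add: y_def)
qed

text \<open>
  The constant \<open>c < 1\<close> pays for replacing \<open>\<eta>\<close> by \<open>1 + \<beta> \<eta>\<close>: the two sides agree at \<open>\<eta> = \<rho>\<close> for the
  \<open>\<beta>\<close> chosen in the proof.
\<close>

lemma power_tail_bound:
  fixes \<rho> c \<nu> :: real
  assumes "0 < \<rho>" "0 < c" "c < 1" "0 < \<nu>"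
  obtains \<beta> where "0 < \<beta>" "\<And>\<eta>. \<rho> < \<eta> \<Longrightarrow> c * (\<eta> / \<rho>) powr (- \<nu>) \<le> 1 / (1 + \<beta> * \<eta>) powr \<nu>"
proof -
  define \<beta> where "\<beta> = (c powr (- (1 / \<nu>)) - 1) / \<rho>"
  have "1 < c powr (- (1 / \<nu>))"
    using powr_less_mono'[of c "- (1 / \<nu>)" 0] assms by simp
  then have "0 < \<beta>" unfolding \<beta>_def using assms by simp
  have "c * (\<eta> / \<rho>) powr (- \<nu>) \<le> 1 / (1 + \<beta> * \<eta>) powr \<nu>" if "\<rho> < \<eta>" for \<eta>
  proof -
    have "1 + \<beta> * \<eta> \<le> (\<eta> / \<rho>) * (1 + \<beta> * \<rho>)" using that assms by (simp add: field_simps)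
    also have "1 + \<beta> * \<rho> = c powr (- (1 / \<nu>))" unfolding \<beta>_def using assms by simp
    finally have "(1 + \<beta> * \<eta>) powr \<nu> \<le> ((\<eta> / \<rho>) * c powr (- (1 / \<nu>))) powr \<nu>"
      using that assms \<open>0 < \<beta>\<close> by (intro powr_mono2) auto
    also have "\<dots> = (\<eta> / \<rho>) powr \<nu> * (c powr (- (1 / \<nu>))) powr \<nu>"
      using that assms by (intro powr_mult)
    also have "(c powr (- (1 / \<nu>))) powr \<nu> = inverse c"
      unfolding powr_powr using assms by (simp add: powr_minus)
    also have "(\<eta> / \<rho>) powr \<nu> * inverse c = (\<eta> / \<rho>) powr \<nu> / c"
      by (simp add: divide_inverse)
    finally have "inverse ((\<eta> / \<rho>) powr \<nu> / c) \<le> inverse ((1 + \<beta> * \<eta>) powr \<nu>)"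
    proof (rule le_imp_inverse_le)
      have "0 < 1 + \<beta> * \<eta>" using that assms \<open>0 < \<beta>\<close> by (intro add_pos_pos mult_pos_pos) auto
      then show "0 < (1 + \<beta> * \<eta>) powr \<nu>" by simp
    qed
    then show ?thesis by (simp add: powr_minus divide_inverse mult_ac)
  qed
  with \<open>0 < \<beta>\<close> that show ?thesis by blast
qed

text \<open>
  Induction over the scales \<open>\<rho> / p ^ n\<close>: at frequency \<open>\<xi>\<close> the equation is driven by \<open>p \<xi>\<close> and \<open>q \<xi>\<close>, which lie
  one scale lower.  For a given time, either \<open>\<xi>\<close> already lies in the core, or it has stayed outside since time 0
  and the envelope can be compared on the whole interval.
\<close>

lemma weak_solution_below_envelope:
  fixes p q b \<rho> k c \<nu> \<xi> t :: real
  assumes ws: "weak_solution p q g0 f"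
    and pos: "0 < \<rho>" "0 < k" "0 < c" "0 < \<nu>" "0 \<le> b"
    and pq: "0 < q" "q \<le> p" "p < 1"
    and core: "1 / (1 + k * (q * \<rho>)\<^sup>2) \<le> c * q powr \<nu>" and tail: "c \<le> q powr \<nu>"
    and near0: "\<And>\<xi> t. 0 \<le> t \<Longrightarrow> \<bar>\<xi>\<bar> * exp (- (b * t)) \<le> \<rho> \<Longrightarrow>
      norm (fourier (f t) \<xi>) \<le> 1 / (1 + k * (\<bar>\<xi>\<bar> * exp (- (b * t)))\<^sup>2)"
    and init: "\<And>\<xi>. \<rho> < \<bar>\<xi>\<bar> \<Longrightarrow> norm (fourier g0 \<xi>) \<le> c * (\<bar>\<xi>\<bar> / \<rho>) powr (- \<nu>)"
    and "0 \<le> t"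
  shows "norm (fourier (f t) \<xi>) \<le> envelope \<rho> k c \<nu> (\<bar>\<xi>\<bar> * exp (- (b * t)))"
proof -
  let ?U = "\<lambda>\<xi> t. envelope \<rho> k c \<nu> (\<bar>\<xi>\<bar> * exp (- (b * t)))"
  have near: "norm (fourier (f t) \<xi>) \<le> ?U \<xi> t"
    if "0 \<le> t" "\<bar>\<xi>\<bar> * exp (- (b * t)) \<le> \<rho>" for \<xi> t
    using near0[OF that] that by (simp add: envelope_def)
  have scales: "norm (fourier (f t) \<xi>) \<le> ?U \<xi> t" if "0 \<le> t" "p ^ n * \<bar>\<xi>\<bar> \<le> \<rho>" for n \<xi> t
    using that
  proof (induction n arbitrary: \<xi> t)
    case 0
    have "\<bar>\<xi>\<bar> * exp (- (b * t)) \<le> \<bar>\<xi>\<bar> * 1"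
      using 0 pos by (intro mult_left_mono) auto
    then show ?case using 0 by (intro near) auto
  next
    case (Suc n)
    show ?case
    proof (cases "\<bar>\<xi>\<bar> * exp (- (b * t)) \<le> \<rho>")
      case True
      then show ?thesis using Suc.prems near by blast
    next
      case False
      have outside: "\<rho> < \<bar>\<xi>\<bar> * exp (- (b * \<tau>))" if "0 \<le> \<tau>" "\<tau> \<le> t" for \<tau>
      proof -
        have "exp (- (b * t)) \<le> exp (- (b * \<tau>))" using that pos by (simp add: mult_left_mono)
        then have "\<bar>\<xi>\<bar> * exp (- (b * t)) \<le> \<bar>\<xi>\<bar> * exp (- (b * \<tau>))"
          by (rule mult_left_mono) simp
        then show ?thesis using False by linarith
      qed
      \<comment> \<open>The envelope along \<open>\<xi>\<close>, which grows in time because the scaled frequency decreases.\<close>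
      define H where "H \<tau> = c * (\<bar>\<xi>\<bar> / \<rho>) powr (- \<nu>) * exp (b * \<nu> * \<tau>)" for \<tau>
      have \<xi>: "\<xi> \<noteq> 0" using outside[of 0] Suc.prems pos by auto
      have UH: "?U \<xi> \<tau> = H \<tau>" if "0 \<le> \<tau>" "\<tau> \<le> t" for \<tau>
      proof -
        have "(\<bar>\<xi>\<bar> * exp (- (b * \<tau>)) / \<rho>) powr (- \<nu>)
            = (\<bar>\<xi>\<bar> / \<rho>) powr (- \<nu>) * exp (- (b * \<tau>)) powr (- \<nu>)"
          using pos by (simp add: powr_mult powr_divide)
        also have "exp (- (b * \<tau>)) powr (- \<nu>) = exp (b * \<nu> * \<tau>)"
          by (simp add: exp_powr_real mult_ac)
        finally show ?thesis using outside[OF that] by (simp add: envelope_def H_def)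
      qed
      have H0: "0 \<le> H \<tau>" for \<tau> unfolding H_def using pos by simp
      have "norm (fourier (f t) \<xi>) \<le> H t"
      proof (rule norm_le_supersolution[OF Suc.prems(1),
            where y = "\<lambda>t. fourier (f t) \<xi>" and H' = "\<lambda>\<tau>. b * \<nu> * H \<tau>"
              and N = "\<lambda>\<tau>. fourier (f \<tau>) (p * \<xi>) * fourier (f \<tau>) (q * \<xi>)"])
        fix \<tau> assume \<tau>: "0 \<le> \<tau>" "\<tau> \<le> t"
        show "((\<lambda>t. fourier (f t) \<xi>) has_vector_derivative
            fourier (f \<tau>) (p * \<xi>) * fourier (f \<tau>) (q * \<xi>) - fourier (f \<tau>) \<xi>) (at \<tau> within {0..})"
          using ws \<tau> unfolding weak_solution_def by blast
        show "(H has_real_derivative b * \<nu> * H \<tau>) (at \<tau>)"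
          unfolding H_def by (rule derivative_eq_intros refl | simp)+
        have step: "norm (fourier (f \<tau>) (r * \<xi>)) \<le> envelope \<rho> k c \<nu> (r * (\<bar>\<xi>\<bar> * exp (- (b * \<tau>))))"
          if r: "0 < r" "r \<le> p" for r
        proof -
          have "p ^ n * \<bar>r * \<xi>\<bar> = r * (p ^ n * \<bar>\<xi>\<bar>)" using r by (simp add: abs_mult)
          also have "\<dots> \<le> p * (p ^ n * \<bar>\<xi>\<bar>)" using r pq by (intro mult_right_mono) auto
          finally have "p ^ n * \<bar>r * \<xi>\<bar> \<le> \<rho>" using Suc.prems(2) by simp
          from Suc.IH[OF \<tau>(1) this] show ?thesis using r by (simp add: abs_mult mult_ac)
        qed
        have "norm (fourier (f \<tau>) (p * \<xi>) * fourier (f \<tau>) (q * \<xi>))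
            \<le> envelope \<rho> k c \<nu> (p * (\<bar>\<xi>\<bar> * exp (- (b * \<tau>)))) * envelope \<rho> k c \<nu> (q * (\<bar>\<xi>\<bar> * exp (- (b * \<tau>))))"
          unfolding norm_mult using step[of p] step[of q] pq
          by (intro mult_mono) (auto intro: order_trans[OF norm_ge_zero])
        also have "\<dots> \<le> ?U \<xi> \<tau>"
          using outside[OF \<tau>] by (intro envelope_product_le pos pq core tail)
        also have "\<dots> = H \<tau>" by (rule UH[OF \<tau>])
        also have "\<dots> \<le> b * \<nu> * H \<tau> + H \<tau>" using pos H0[of \<tau>] by simp
        finally show "norm (fourier (f \<tau>) (p * \<xi>) * fourier (f \<tau>) (q * \<xi>)) \<le> b * \<nu> * H \<tau> + H \<tau>" .
      next
        have "fourier (f 0) \<xi> = fourier g0 \<xi>"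
          using ws unfolding weak_solution_def by blast
        then show "norm (fourier (f 0) \<xi>) \<le> H 0"
          using init[of \<xi>] outside[of 0] Suc.prems by (simp add: H_def)
      qed
      also have "\<dots> = ?U \<xi> t" using UH[of t] Suc.prems by simp
      finally show ?thesis .
    qed
  qed
  have "(\<lambda>n. p ^ n * \<bar>\<xi>\<bar>) \<longlonglongrightarrow> 0 * \<bar>\<xi>\<bar>"
    using pq by (intro tendsto_intros LIMSEQ_power_zero) auto
  then have "eventually (\<lambda>n. p ^ n * \<bar>\<xi>\<bar> < \<rho>) sequentially"
    using pos by (intro order_tendstoD(2)) auto
  then obtain n where "p ^ n * \<bar>\<xi>\<bar> < \<rho>" using eventually_happens'[OF sequentially_bot] by blast
  then show ?thesis using scales[OF \<open>0 \<le> t\<close>, of n \<xi>] by simp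
qed

section \<open>Uniform decay of the scaled solution\<close>

theorem theorem1:
  fixes p q \<delta>' R \<nu> \<beta> :: real
    and g0 :: "real \<Rightarrow> real"
    and g :: "real \<Rightarrow> real \<Rightarrow> real"
  assumes "0 < q" and "q \<le> p" and "p\<^sup>2 + q\<^sup>2 < 1"
    and "0 < \<delta>'" and "\<delta>' < 1"
    and "\<And>\<delta>. 0 < \<delta> \<Longrightarrow> \<delta> < \<delta>' \<Longrightarrow> S_fun p q \<delta> < 0"
    and "\<And>v. 0 \<le> g0 v"
    and "has_bochner_integral lebesgue g0 1"
    and "has_bochner_integral lebesgue (\<lambda>v. v * g0 v) 0"
    and "has_bochner_integral lebesgue (\<lambda>v. v\<^sup>2 * g0 v) 1"
    and "integrable lebesgue (\<lambda>v. \<bar>v\<bar> powr (2 + \<delta>') * g0 v)"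
    and "scaled_weak_solution p q g0 g"
    and "0 < R" and "0 < \<nu>" and "0 < \<beta>"
    and "\<And>\<xi>. \<bar>\<xi>\<bar> > R \<Longrightarrow> norm (fourier g0 \<xi>) \<le> 1 / (1 + \<beta> * \<bar>\<xi>\<bar>) powr \<nu>"
  shows "\<exists>\<rho>>0. \<exists>k>0. \<exists>\<beta>'>0. \<exists>\<nu>'>0. \<forall>t\<ge>0.
           (\<forall>\<xi>. \<bar>\<xi>\<bar> \<le> \<rho> \<longrightarrow> norm (fourier (g t) \<xi>) \<le> 1 / (1 + k * \<xi>\<^sup>2)) \<and>
           (\<forall>\<xi>. \<bar>\<xi>\<bar> > \<rho> \<longrightarrow> norm (fourier (g t) \<xi>) \<le> 1 / (1 + \<beta>' * \<bar>\<xi>\<bar>) powr \<nu>')"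
proof -
  obtain f where ws: "weak_solution p q g0 f"
    and g: "\<forall>t\<ge>0. \<forall>v. g t v = sqrt (second_moment (f t)) * f t (v * sqrt (second_moment (f t)))"
    using assms(12) unfolding scaled_weak_solution_def by (elim exE conjE)
  have p0: "0 < p" using assms(1,2) by simp
  have p1: "p < 1"
  proof (rule ccontr)
    assume "\<not> p < 1"
    then have "1 \<le> p\<^sup>2" by (simp add: one_le_power)
    then show False using assms(3) zero_le_power2[of q] by linarith
  qed
  define b where "b = (1 - p\<^sup>2 - q\<^sup>2) / 2"
  have b: "0 < b" unfolding b_def using assms(3) by simp
  \<comment> \<open>An interior exponent, since \<open>S\<close> may vanish at \<open>\<delta>'\<close> itself.\<close>
  define \<delta> where "\<delta> = \<delta>' / 2"
  define s where "s = 2 + \<delta>"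
  have \<delta>: "0 < \<delta>" "\<delta> < \<delta>'" unfolding \<delta>_def using assms(4) by auto
  have s: "2 < s" "s \<le> 3" unfolding s_def using \<delta> assms(5) by auto
  define \<sigma> where "\<sigma> = - S_fun p q \<delta>"
  have \<sigma>: "0 < \<sigma>" unfolding \<sigma>_def using assms(6)[OF \<delta>] by simp
  have \<sigma>_eq: "p powr s + q powr s + \<sigma> = 1 - b * s"
    unfolding \<sigma>_def S_fun_def s_def b_def by (simp add: field_simps)

  have int_g0: "integrable lebesgue g0" and mass_g0: "(LINT v|lebesgue. g0 v) = 1"
    using assms(8) by (auto simp: has_bochner_integral_iff)
  have moment: "integrable lebesgue (\<lambda>v. \<bar>v\<bar> powr s * g0 v)"
  proof (rule Bochner_Integration.integrable_bound)
    show "integrable lebesgue (\<lambda>v. v\<^sup>2 * g0 v + \<bar>v\<bar> powr (2 + \<delta>') * g0 v)"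
      using assms(10,11) by (auto simp: has_bochner_integral_iff)
    have [measurable]: "g0 \<in> borel_measurable lebesgue" using int_g0 by auto
    have [measurable]: "(\<lambda>v::real. \<bar>v\<bar> powr s) \<in> borel_measurable lebesgue"
      by (rule measurable_completion) measurable
    show "(\<lambda>v. \<bar>v\<bar> powr s * g0 v) \<in> borel_measurable lebesgue" by measurable
    have "\<bar>v\<bar> powr s \<le> v\<^sup>2 + \<bar>v\<bar> powr (2 + \<delta>')" for v :: real
    proof (cases "\<bar>v\<bar> \<le> 1")
      case True
      have "\<bar>v\<bar> powr s \<le> v\<^sup>2"
      proof (cases "v = 0")
        case False
        then have "\<bar>v\<bar> powr s \<le> \<bar>v\<bar> powr 2" using s True by (intro powr_mono') auto
        then show ?thesis using False by (simp add: powr_numeral)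
      qed simp
      then show ?thesis by (simp add: add_increasing2)
    next
      case False
      then have "\<bar>v\<bar> powr s \<le> \<bar>v\<bar> powr (2 + \<delta>')" unfolding s_def using \<delta> by (intro powr_mono) auto
      then show ?thesis by (simp add: add_increasing)
    qed
    then have "\<bar>v\<bar> powr s * g0 v \<le> (v\<^sup>2 + \<bar>v\<bar> powr (2 + \<delta>')) * g0 v" for v
      using assms(7) by (intro mult_right_mono)
    then show "AE v in lebesgue. norm (\<bar>v\<bar> powr s * g0 v)
        \<le> norm (v\<^sup>2 * g0 v + \<bar>v\<bar> powr (2 + \<delta>') * g0 v)"
      using assms(7) by (intro AE_I2) (simp add: algebra_simps abs_of_nonneg)
  qed
  have mass: "fourier g0 0 = 1"
    unfolding fourier_def using mass_g0 by simp

  \<comment> \<open>\<open>K\<close> must dominate the initial error and, through \<open>K * \<sigma> \<ge> 1\<close>, the residual of the Gaussian.\<close>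
  define W where "W = (LINT v|lebesgue. \<bar>v\<bar> powr s * g0 v) + 1"
  define K where "K = max W (1 / \<sigma>)"
  have K0: "0 < K" unfolding K_def using \<sigma> by (simp add: less_max_iff_disj)
  have K: "K * (p powr s + q powr s) + 1 \<le> K * (1 - b * s)"
  proof -
    have "1 \<le> K * \<sigma>" unfolding K_def using \<sigma> by (simp add: field_simps max_def) 
    then show ?thesis unfolding \<sigma>_eq[symmetric] by (simp add: algebra_simps)
  qed
  have init_gauss: "norm (fourier g0 \<xi> - complex_of_real (exp (- (\<xi>\<^sup>2 / 2)))) \<le> K * \<bar>\<xi>\<bar> powr s" for \<xi>
  proof -
    have "norm (fourier g0 \<xi> - complex_of_real (exp (- (\<xi>\<^sup>2 / 2)))) \<le> W * \<bar>\<xi>\<bar> powr s"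
      unfolding W_def using s by (intro fourier_gaussian_initial assms moment) auto
    also have "\<dots> \<le> K * \<bar>\<xi>\<bar> powr s" unfolding K_def by (intro mult_right_mono) auto
    finally show ?thesis .
  qed
  have gauss: "norm (fourier (f t) \<xi> - complex_of_real (exp (- (exp (- (2 * b * t)) * \<xi>\<^sup>2 / 2))))
      \<le> K * (\<bar>\<xi>\<bar> powr s * exp (- (b * s * t)))" if "0 \<le> t" for t \<xi>
    using s that by (intro weak_solution_near_gaussian[OF ws mass p0 assms(1) b_def b _ _ K _ init_gauss])
      (auto intro: less_imp_le K0)

  have energy: "second_moment (f t) = exp (- (2 * b * t))" if "0 \<le> t" for t
  proof (rule second_moment_of_near_gaussian[OF _ _ s(1)])
    show "integrable lebesgue (f t)" "AE v in lebesgue. 0 \<le> f t v"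
      using ws that unfolding weak_solution_def C1_L1_def by auto
    show "norm (fourier (f t) \<xi> - complex_of_real (exp (- (exp (- (2 * b * t)) * \<xi>\<^sup>2 / 2))))
        \<le> (K * exp (- (b * s * t))) * \<bar>\<xi>\<bar> powr s" for \<xi>
      using gauss[OF that, of \<xi>] by (simp add: mult_ac)
  qed
  have fourier_g: "fourier (g t) \<xi> = fourier (f t) (\<xi> / exp (- (b * t)))" if "0 \<le> t" for t \<xi>
  proof -
    have "sqrt (exp (- (2 * b * t))) = exp (- (b * t))"
      by (rule real_sqrt_unique) (simp_all add: power2_eq_square flip: exp_add)
    then have "g t = (\<lambda>v. exp (- (b * t)) * f t (v * exp (- (b * t))))"
      using g that energy[OF that] by auto
    then show ?thesis using fourier_rescale[of "exp (- (b * t))" "f t" \<xi>] by simp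
  qed

  define \<rho> where "\<rho> = min 1 ((1 / (8 * K)) powr (1 / \<delta>))"
  have \<rho>: "0 < \<rho>" "\<rho> \<le> 1" unfolding \<rho>_def using K0 by auto
  have \<rho>K: "K * \<rho> powr \<delta> \<le> 1 / 8"
  proof -
    have "\<rho> powr \<delta> \<le> ((1 / (8 * K)) powr (1 / \<delta>)) powr \<delta>"
      using \<rho> \<delta> by (intro powr_mono2) (auto simp: \<rho>_def)
    also have "\<dots> = 1 / (8 * K)" unfolding powr_powr using \<delta> K0 by simp
    finally show ?thesis using K0 by (simp add: field_simps)
  qed
  have near0: "norm (fourier (f t) \<xi>) \<le> 1 / (1 + (1 / 4) * (\<bar>\<xi>\<bar> * exp (- (b * t)))\<^sup>2)"
    if t: "0 \<le> t" and small: "\<bar>\<xi>\<bar> * exp (- (b * t)) \<le> \<rho>" for \<xi> t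
  proof -
    let ?\<eta> = "\<bar>\<xi>\<bar> * exp (- (b * t))"
    let ?G = "complex_of_real (exp (- (?\<eta>\<^sup>2 / 2)))"
    have e2: "exp (- (2 * b * t)) * \<xi>\<^sup>2 = ?\<eta>\<^sup>2"
      by (simp add: power_mult_distrib power2_eq_square[of "exp _"] flip: exp_add)
    have es: "\<bar>\<xi>\<bar> powr s * exp (- (b * s * t)) = ?\<eta> powr s"
      by (simp add: powr_mult exp_powr_real mult_ac)
    have "norm (fourier (f t) \<xi>) \<le> norm ?G + norm (fourier (f t) \<xi> - ?G)"
      using norm_triangle_ineq[of ?G "fourier (f t) \<xi> - ?G"] by simp
    moreover have "norm ?G = exp (- (?\<eta>\<^sup>2 / 2))" by (simp only: norm_of_real abs_exp_cancel)
    moreover have "norm (fourier (f t) \<xi> - ?G) \<le> K * ?\<eta> powr (2 + \<delta>)"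
      using gauss[OF t, of \<xi>] unfolding e2 es unfolding s_def .
    moreover have "exp (- (?\<eta>\<^sup>2 / 2)) + K * ?\<eta> powr (2 + \<delta>) \<le> 1 / (1 + (1 / 4) * ?\<eta>\<^sup>2)"
      using K0 small by (intro gaussian_core_bound[OF \<delta>(1) _ \<rho>K \<rho>(2)]) auto
    ultimately show ?thesis by linarith
  qed

  define z where "z = (q * \<rho>)\<^sup>2"
  define \<theta> where "\<theta> = 1 / (1 + (1 / 4) * z)"
  have "0 < z" unfolding z_def using assms(1) \<rho> by simp
  then have \<theta>: "0 < \<theta>" "\<theta> < 1" unfolding \<theta>_def by (simp_all add: field_simps)
  have less: "norm (fourier g0 \<xi>) < 1" if "\<xi> \<noteq> 0" for \<xi>
    using assms(7) by (intro norm_fourier_less_mass int_g0 mass_g0 that) simp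
  obtain c \<nu>' where c: "0 < c" "c < 1" "0 < \<nu>'" "\<theta> \<le> c * q powr \<nu>'" "c \<le> q powr \<nu>'"
    and init_tail: "\<And>\<xi>. \<rho> < \<bar>\<xi>\<bar> \<Longrightarrow> norm (fourier g0 \<xi>) \<le> c * (\<bar>\<xi>\<bar> / \<rho>) powr (- \<nu>')"
    using envelope_parameters[OF assms(1) \<rho>(1) assms(13,15,14) \<theta>
        continuous_on_fourier[OF int_g0] less assms(16)] by blast
  obtain \<beta>' where \<beta>': "0 < \<beta>'" "\<And>\<eta>. \<rho> < \<eta> \<Longrightarrow> c * (\<eta> / \<rho>) powr (- \<nu>') \<le> 1 / (1 + \<beta>' * \<eta>) powr \<nu>'"
    by (rule power_tail_bound[OF \<rho>(1) c(1-3)], rule that)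
  have envelope_g: "norm (fourier (g t) \<xi>) \<le> envelope \<rho> (1 / 4) c \<nu>' \<bar>\<xi>\<bar>" if "0 \<le> t" for t \<xi>
  proof -
    have "norm (fourier (f t) (\<xi> / exp (- (b * t))))
        \<le> envelope \<rho> (1 / 4) c \<nu>' (\<bar>\<xi> / exp (- (b * t))\<bar> * exp (- (b * t)))"
    proof (rule weak_solution_below_envelope[OF ws \<rho>(1) _ c(1) c(3) _ assms(1,2) p1 _ c(5) near0 init_tail that])
      show "1 / (1 + 1 / 4 * (q * \<rho>)\<^sup>2) \<le> c * q powr \<nu>'"
        using c(4) unfolding \<theta>_def z_def .
    qed (use b in simp_all)
    then show ?thesis by (simp add: fourier_g[OF that])
  qed
  have inner: "norm (fourier (g t) \<xi>) \<le> 1 / (1 + (1 / 4) * \<xi>\<^sup>2)"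
    if "0 \<le> t" "\<bar>\<xi>\<bar> \<le> \<rho>" for t \<xi>
    using envelope_g[OF that(1), of \<xi>] that(2) by (simp add: envelope_def)
  have outer: "norm (fourier (g t) \<xi>) \<le> 1 / (1 + \<beta>' * \<bar>\<xi>\<bar>) powr \<nu>'"
    if "0 \<le> t" "\<rho> < \<bar>\<xi>\<bar>" for t \<xi>
  proof -
    have "norm (fourier (g t) \<xi>) \<le> c * (\<bar>\<xi>\<bar> / \<rho>) powr (- \<nu>')"
      using envelope_g[OF that(1), of \<xi>] that(2) by (simp add: envelope_def)
    also have "\<dots> \<le> 1 / (1 + \<beta>' * \<bar>\<xi>\<bar>) powr \<nu>'"
      by (rule \<beta>'(2)[OF that(2)])
    finally show ?thesis .
  qed
  show ?thesis
  proof (rule exI[of _ \<rho>], intro conjI \<rho>(1), rule exI[of _ "1 / 4"], intro conjI,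
      simp, rule exI[of _ \<beta>'], intro conjI \<beta>'(1), rule exI[of _ \<nu>'], intro conjI c(3) allI impI)
  qed (use inner outer in simp_all)
qed

end
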